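(* There exist constants $C_0,C>0$ such that, if $N\ge1$ is an integer, $\mu\ge0$, $\boldsymbol\beta=(\beta_0,\beta_\pi)\in\mathbb R^2$ and \[ N\ge C_0(1+\mu^2),\qquad |\beta_0|+|\beta_\pi|\le\mu, \] then for every $f\in\mathcal V$ \[ \mathfrak a_{\boldsymbol\beta}[f,f]\ge\frac12\,\mathfrak a_0[P_{>N}f,P_{>N}f]-CN^2\|P_{\le N}f\|_{\mathcal H}^2 . \]
   Context: Let $\omega(\varphi)=(\sin\varphi)^{1/2}$ and $\mathcal H=L^2((0,\pi),\omega\,d\varphi)$. Let $\mathfrak a_0[f,g]=4\int_0^\pi\omega f'\,\overline{g'}\,d\varphi$ with form domain $\mathcal V=\{f\in\mathcal H: f\in H^1_{\mathrm{loc}}(0,\pi),\ \int_0^\pi\omega|f'|^2\,d\varphi<\infty\}$; $A_0$ is the associated self-adjoint operator. Elements of $\mathcal V$ have well-defined endpoint values $f(0),f(\pi)$. The Robin form is $\mathfrak a_{\boldsymbol\beta}[f,g]=\mathfrak a_0[f,g]+\beta_0f(0)\overline{g(0)}+\beta_\pi f(\pi)\overline{g(\pi)}$ on $\mathcal V$. $\{\Phi_n\}_{n\ge0}$ is the orthonormal basis of $\mathcal H$ with $\Phi_n(\varphi)=\mathfrak h_n^{-1/2}C_n^{1/4}(\cos\varphi)$ ($C_n^{1/4}$ Gegenbauer polynomials, $\mathfrak h_n>0$ normalizing), $A_0\Phi_n=2n(2n+1)\Phi_n$. $P_{\le N}$ is the orthogonal projector in $\mathcal H$ onto $\operatorname{span}\{\Phi_0,\dots,\Phi_N\}$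 and $P_{>N}=I-P_{\le N}$. *)

theory Defs
  imports "HOL-Analysis.Analysis"
begin

text \<open>Elements of function spaces on the interval are represented by functions
  \<open>real \<Rightarrow> complex\<close>; values outside \<open>(0, \<pi>)\<close> and on null sets play no role.\<close>

abbreviation I0pi :: "real set" where
  "I0pi \<equiv> {0<..<pi}"

definition omega :: "real \<Rightarrow> real" where
  "omega x = sqrt (sin x)"

definition H_space :: "(real \<Rightarrow> complex) set" where
  "H_space = {f. f \<in> borel_measurable (lebesgue_on I0pi) \<and>
                 integrable (lebesgue_on I0pi) (\<lambda>x. omega x * (cmod (f x))\<^sup>2)}"

definition H_inner :: "(real \<Rightarrow> complex) \<Rightarrow> (real \<Rightarrow> complex) \<Rightarrow> complex" where
  "H_inner f g = (LINT x|lebesgue_on I0pi. of_real (omega x) * f x * cnj (g x))"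

definition H_norm :: "(real \<Rightarrow> complex) \<Rightarrow> real" where
  "H_norm f = sqrt (LINT x|lebesgue_on I0pi. omega x * (cmod (f x))\<^sup>2)"

definition L1_loc :: "(real \<Rightarrow> complex) set" where
  "L1_loc = {f. f \<in> borel_measurable (lebesgue_on I0pi) \<and>
                (\<forall>a b. 0 < a \<longrightarrow> b < pi \<longrightarrow> integrable (lebesgue_on {a..b}) f)}"

definition L2_loc :: "(real \<Rightarrow> complex) set" where
  "L2_loc = {f. f \<in> borel_measurable (lebesgue_on I0pi) \<and>
                (\<forall>a b. 0 < a \<longrightarrow> b < pi \<longrightarrow> integrable (lebesgue_on {a..b}) (\<lambda>x. (cmod (f x))\<^sup>2))}"

text \<open>The test functions \<open>C\<^sub>c\<^sup>\<infinity>(0, \<pi>)\<close>, extended by zero to the real line.\<close>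

definition test_functions :: "(real \<Rightarrow> real) set" where
  "test_functions = {\<eta>. (\<forall>k x. ((deriv ^^ k) \<eta>) field_differentiable (at x)) \<and>
                         (\<exists>a b. 0 < a \<and> b < pi \<and> (\<forall>x. x \<notin> {a..b} \<longrightarrow> \<eta> x = 0))}"

definition has_weak_deriv :: "(real \<Rightarrow> complex) \<Rightarrow> (real \<Rightarrow> complex) \<Rightarrow> bool" where
  "has_weak_deriv f g \<longleftrightarrow> f \<in> L1_loc \<and> g \<in> L1_loc \<and>
     (\<forall>\<eta>\<in>test_functions.
        (LINT x|lebesgue_on I0pi. f x * of_real (deriv \<eta> x))
        = - (LINT x|lebesgue_on I0pi. g x * of_real (\<eta> x)))"

text \<open>The weak derivative is unique only up to null sets, so some representative is chosen;
  everything below depends on it only through integrals.\<close>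

definition weak_deriv :: "(real \<Rightarrow> complex) \<Rightarrow> real \<Rightarrow> complex" where
  "weak_deriv f = (SOME g. has_weak_deriv f g)"

definition H1_loc :: "(real \<Rightarrow> complex) set" where
  "H1_loc = {f. f \<in> L2_loc \<and> (\<exists>g\<in>L2_loc. has_weak_deriv f g)}"

definition V_space :: "(real \<Rightarrow> complex) set" where
  "V_space = {f. f \<in> H_space \<and> f \<in> H1_loc \<and>
                 integrable (lebesgue_on I0pi) (\<lambda>x. omega x * (cmod (weak_deriv f x))\<^sup>2)}"

definition a0_form :: "(real \<Rightarrow> complex) \<Rightarrow> (real \<Rightarrow> complex) \<Rightarrow> complex" where
  "a0_form f g =
     4 * (LINT x|lebesgue_on I0pi. of_real (omega x) * weak_deriv f x * cnj (weak_deriv g x))"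

text \<open>The value at an endpoint \<open>x0 \<in> {0, \<pi>}\<close> is the limit there of the continuous
  representative of \<open>f\<close> on the open interval.\<close>

definition endpoint_value :: "(real \<Rightarrow> complex) \<Rightarrow> real \<Rightarrow> complex" where
  "endpoint_value f x0 =
     (THE c. \<exists>g. continuous_on I0pi g \<and> (AE x in lebesgue_on I0pi. g x = f x) \<and>
                 (g \<longlongrightarrow> c) (at x0 within I0pi))"

definition robin_form ::
  "real \<Rightarrow> real \<Rightarrow> (real \<Rightarrow> complex) \<Rightarrow> (real \<Rightarrow> complex) \<Rightarrow> complex" where
  "robin_form \<beta>0 \<beta>\<pi> f g = a0_form f g
     + of_real \<beta>0 * endpoint_value f 0 * cnj (endpoint_value g 0)
     + of_real \<beta>\<pi> * endpoint_value f pi * cnj (endpoint_value g pi)"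

text \<open>Gegenbauer polynomials \<open>C\<^sub>n\<^sup>\<lambda>(x)\<close> in the standard normalization (generating function
  \<open>(1 - 2 x t + t\<^sup>2) powr -\<lambda>\<close>), given by their three-term recurrence.\<close>

fun gegenbauer :: "real \<Rightarrow> nat \<Rightarrow> real \<Rightarrow> real" where
  "gegenbauer l 0 x = 1"
| "gegenbauer l (Suc 0) x = 2 * l * x"
| "gegenbauer l (Suc (Suc n)) x =
     (2 * (real n + 1 + l) * x * gegenbauer l (Suc n) x - (real n + 2 * l) * gegenbauer l n x)
       / (real n + 2)"

definition h_norm :: "nat \<Rightarrow> real" where
  "h_norm n = (LINT x|lebesgue_on I0pi. omega x * (gegenbauer (1/4) n (cos x))\<^sup>2)"

definition Phi :: "nat \<Rightarrow> real \<Rightarrow> complex" where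
  "Phi n x = of_real (gegenbauer (1/4) n (cos x) / sqrt (h_norm n))"

definition Phi_span :: "nat \<Rightarrow> (real \<Rightarrow> complex) set" where
  "Phi_span N = range (\<lambda>c :: nat \<Rightarrow> complex. \<lambda>x. \<Sum>n\<le>N. c n * Phi n x)"

text \<open>The orthogonal projection onto \<open>Phi_span N\<close>. Its elements are trigonometric polynomials,
  so the description determines the function itself and not just its class modulo null sets.\<close>

definition P_le :: "nat \<Rightarrow> (real \<Rightarrow> complex) \<Rightarrow> real \<Rightarrow> complex" where
  "P_le N f = (THE p. p \<in> Phi_span N \<and> (\<forall>q\<in>Phi_span N. H_inner (\<lambda>x. f x - p x) q = 0))"

definition P_gt :: "nat \<Rightarrow> (real \<Rightarrow> complex) \<Rightarrow> real \<Rightarrow> complex" where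
  "P_gt N f = (\<lambda>x. f x - P_le N f x)"

text \<open>The quadratic forms are real, so passing to real parts in inequalities loses nothing.\<close>

lemma a0_form_diag:
  "a0_form f f
     = of_real (4 * (LINT x|lebesgue_on I0pi. omega x * (cmod (weak_deriv f x))\<^sup>2))"
proof -
  have "(\<lambda>x. of_real (omega x) * weak_deriv f x * cnj (weak_deriv f x))
        = (\<lambda>x. complex_of_real (omega x * (cmod (weak_deriv f x))\<^sup>2))"
    by (simp add: mult.assoc complex_norm_square[symmetric] del: of_real_power)
  then show ?thesis
    unfolding a0_form_def by (simp only: integral_complex_of_real) simp
qed

lemma robin_form_diag_real: "Im (robin_form \<beta>0 \<beta>\<pi> f f) = 0"
  unfolding robin_form_def a0_form_diag by (simp add: mult.assoc complex_norm_square[symmetric])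

end

theory Submission
  imports Defs
begin

text \<open>
  Split \<open>f = p + q\<close> with \<open>p = P_le N f\<close> and \<open>q = P_gt N f\<close>, let \<open>g\<close> be the weak derivative of \<open>f\<close>
  and \<open>q'\<close> that of \<open>q\<close>, and write \<open>|u|\<close> for the norm of \<open>u\<close> in \<open>\<H>\<close>, so that the form without
  boundary terms is \<open>4 |g|\<^sup>2\<close>. Two inequalities carry the proof.

  The trace inequality: \<open>1 / omega\<close> is of order \<open>t powr (-1/2)\<close> at distance \<open>t\<close> from an endpoint, so
  its integral over distance \<open>\<delta>\<close> is of order \<open>sqrt \<delta>\<close>. Integrating by parts against a cutoff of width
  \<open>\<delta>\<close> and applying Cauchy-Schwarz bounds the square of an endpoint value of \<open>f\<close> by
  \<open>24 (sqrt \<delta> |g|\<^sup>2 + sqrt \<delta> / \<delta>\<^sup>2 |f|\<^sup>2)\<close> (\<open>trace_inequality\<close>).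

  The spectral gap: \<open>N\<^sup>2 |q|\<^sup>2 \<le> |q'|\<^sup>2\<close>. Each \<open>Phi n\<close> solves its eigenvalue equation
  weakly against every element of the form domain (\<open>weak_eigenfunction_identity\<close>, which rests on the
  Gegenbauer differential equation and on \<open>omega\<close> vanishing at the endpoints). Hence the derivatives
  \<open>dPhi n\<close> are orthogonal too, and \<open>g\<close> has the same coefficients with respect to them as \<open>f\<close> has with
  respect to the \<open>Phi n\<close>. Bessel's inequality for \<open>g\<close> and completeness of the \<open>Phi n\<close> for \<open>f\<close> then
  give \<open>spectral_gap\<close>. Completeness is Weierstrass' theorem: \<open>f\<close> has a representative that is
  continuous up to the endpoints, hence a uniform limit of polynomials in \<open>cos x\<close>.

  With \<open>\<delta> = 1 / N\<close> the boundary terms are at most \<open>24 \<mu> / sqrt N\<close> times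
  \<open>|g|\<^sup>2 + N\<^sup>2 |f|\<^sup>2\<close>, and the factor is at most \<open>1\<close> once \<open>N \<ge> 24\<^sup>2 \<mu>\<^sup>2\<close>. Of \<open>4 |g|\<^sup>2\<close> one part pays
  for \<open>|g|\<^sup>2\<close> and one for \<open>N\<^sup>2 |q|\<^sup>2 \<le> |q'|\<^sup>2 \<le> |g|\<^sup>2\<close>; what remains is at least
  \<open>2 |q'|\<^sup>2\<close>, half of the form at \<open>q\<close>, and only \<open>N\<^sup>2 |p|\<^sup>2\<close> is lost.

  All this needs the link between distributional derivatives and actual functions: an element of
  \<open>V_space\<close> agrees almost everywhere with a primitive of its weak derivative
  (\<open>has_weak_deriv_imp_is_primitive\<close>, the lemma of du Bois-Reymond), and that derivative is integrable
  because \<open>1 / omega\<close> is. From then on one integration by parts, proved by Fubini's theorem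
  for primitives of integrable functions, serves every purpose.
\<close>

section \<open>Smooth bump functions\<close>

text \<open>
  The powers of \<open>1/x\<close> are included because derivatives of \<open>exp (- 1/x)\<close> produce them: the span of
  this family is closed under differentiation.
\<close>

definition flat :: "nat \<Rightarrow> real \<Rightarrow> real" where
  "flat n x = (if x > 0 then (1/x)^n * exp (- (1/x)) else 0)"

lemma flat_over_self_tendsto_0: "((\<lambda>h. flat n h / h) \<longlongrightarrow> 0) (at 0)"
proof -
  have "((\<lambda>h::real. (1/h)^(Suc n) / exp (1/h)) \<longlongrightarrow> 0) (at_right 0)"
    using filterlim_compose[OF tendsto_power_div_exp_0[of "Suc n"] filterlim_inverse_at_top_right]
    by (simp add: inverse_eq_divide)
  then have "((\<lambda>h. flat n h / h) \<longlongrightarrow> 0) (at_right 0)"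
    by (rule Lim_transform_eventually)
       (auto simp: flat_def exp_minus field_simps eventually_at_right_field intro!: exI[of _ 1])
  moreover have "((\<lambda>h. flat n h / h) \<longlongrightarrow> 0) (at_left 0)"
    by (rule Lim_transform_eventually[OF tendsto_const])
       (auto simp: flat_def eventually_at_left_field intro!: exI[of _ "-1"])
  ultimately show ?thesis
    by (rule filterlim_split_at_real[rotated])
qed

lemma DERIV_flat:
  "(flat n has_field_derivative (flat (n+2) x - real n * flat (n+1) x)) (at x)"
proof (cases "x = 0")
  case True
  then show ?thesis
    using flat_over_self_tendsto_0[of n] by (simp add: has_field_derivative_iff flat_def)
next
  case False
  show ?thesis
  proof (cases "x > 0")
    case True
    have inv: "((\<lambda>x. 1/x) has_field_derivative - ((1/x)^2)) (at x)"
      using True by (auto intro!: derivative_eq_intros simp: field_simps power2_eq_square)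
    have "real n * ((1/x)^(n - 1) * (1/x)^2) = real n * (1/x)^(n+1)"
      by (cases n) (simp_all add: power2_eq_square)
    then have "((\<lambda>x. (1/x)^n) has_field_derivative - (real n * (1/x)^(n+1))) (at x)"
      using DERIV_power[OF inv, of n] by (simp add: mult_ac)
    from DERIV_mult[OF this DERIV_fun_exp[OF DERIV_minus[OF inv]]]
    have "((\<lambda>x. (1/x)^n * exp (- (1/x))) has_field_derivative
        (1/x)^(n+2) * exp (- (1/x)) - real n * ((1/x)^(n+1) * exp (- (1/x)))) (at x)"
      by (rule back_subst[of "\<lambda>d. (_ has_field_derivative d) (at x)"])
         (simp add: algebra_simps power_add power2_eq_square)
    moreover have "\<forall>\<^sub>F y in nhds x. (1/y)^n * exp (- (1/y)) = flat n y"
      using eventually_nhds_in_open[of "{0<..}" x] True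
      by (auto elim!: eventually_mono simp: flat_def)
    ultimately show ?thesis
      using True by (subst (asm) DERIV_cong_ev[OF refl _ refl]) (auto simp: flat_def)
  next
    case nonpos: False
    have "\<forall>\<^sub>F y in nhds x. (\<lambda>_. 0) y = flat n y"
      using eventually_nhds_in_open[of "{..<0}" x] nonpos False
      by (auto elim!: eventually_mono simp: flat_def)
    then show ?thesis
      using nonpos DERIV_cong_ev[OF refl, of "\<lambda>_. 0" "flat n" x 0 0] by (auto simp: flat_def)
  qed
qed

lemma DERIV_flat_comp [derivative_intros]:
  assumes "(g has_field_derivative g') (at x)"
  shows "((\<lambda>x. flat n (g x)) has_field_derivative
           ((flat (n+2) (g x) - real n * flat (n+1) (g x)) * g')) (at x)"
  using DERIV_chain2[OF DERIV_flat assms] by simp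

text \<open>
  Sums of products of a rising and a falling flat function. The factors of one summand keep their
  points \<open>a\<close>, \<open>b\<close> and scale \<open>k\<close> under differentiation, so this set is closed under derivatives
  by the product rule alone.
\<close>

inductive_set flat_products :: "(real \<Rightarrow> real) set" where
  product: "(\<lambda>x. c * flat m (k * (x - a)) * flat n (k * (b - x))) \<in> flat_products"
| add: "f \<in> flat_products \<Longrightarrow> g \<in> flat_products \<Longrightarrow> (\<lambda>x. f x + g x) \<in> flat_products"

lemma flat_products_deriv:
  "f \<in> flat_products \<Longrightarrow> \<exists>f'\<in>flat_products. \<forall>x. (f has_field_derivative f' x) (at x)"
proof (induction rule: flat_products.induct)
  case (product c m k a n b)
  let ?p = "\<lambda>c m n x. c * flat m (k * (x - a)) * flat n (k * (b - x))"
  let ?f' = "\<lambda>x. ((?p (c*k) (m+2) n x + ?p (- c*k*real m) (m+1) n x)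
     + ?p (- c*k) m (n+2) x) + ?p (c*k*real n) m (n+1) x"
  have "?f' \<in> flat_products"
    by (intro flat_products.intros)
  moreover have "(?p c m n has_field_derivative ?f' x) (at x)" for x
    by (auto intro!: derivative_eq_intros simp: algebra_simps)
  ultimately show ?case
    by (intro bexI[of _ ?f']) auto
next
  case (add f g)
  then obtain f' g' where "f' \<in> flat_products" "g' \<in> flat_products"
    "\<forall>x. (f has_field_derivative f' x) (at x)" "\<forall>x. (g has_field_derivative g' x) (at x)"
    by blast
  then show ?case
    by (intro bexI[of _ "\<lambda>x. f' x + g' x"])
       (auto intro!: derivative_eq_intros flat_products.intros)
qed

definition smooth_real :: "(real \<Rightarrow> real) \<Rightarrow> bool" where
  "smooth_real f \<longleftrightarrow> (\<forall>k x. ((deriv ^^ k) f) field_differentiable (at x))"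

text \<open>
  Coinduction for smoothness: a set of functions that contains a derivative of each member contains
  all iterated derivatives.
\<close>

lemma smooth_realI:
  assumes "f \<in> S" and "\<And>g. g \<in> S \<Longrightarrow> \<exists>g'\<in>S. \<forall>x. (g has_field_derivative g' x) (at x)"
  shows "smooth_real f"
proof -
  have "(deriv ^^ k) f \<in> S" for k
  proof (induction k)
    case (Suc k)
    then obtain g' where g': "g' \<in> S" "\<forall>x. ((deriv ^^ k) f has_field_derivative g' x) (at x)"
      using assms(2) by blast
    then have "deriv ((deriv ^^ k) f) = g'"
      by (auto intro!: DERIV_imp_deriv)
    with g' show ?case by simp
  qed (use assms in simp)
  then show ?thesis
    unfolding smooth_real_def field_differentiable_def using assms(2) by blast
qed

lemma smooth_real_has_deriv:
  assumes "smooth_real f"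
  shows "(f has_field_derivative deriv f x) (at x)" "smooth_real (deriv f)"
proof -
  show "(f has_field_derivative deriv f x) (at x)"
    using assms unfolding smooth_real_def
    by (metis field_differentiable_derivI funpow_0)
  have "(deriv ^^ k) (deriv f) = (deriv ^^ Suc k) f" for k
    by (simp only: funpow_Suc_right o_apply)
  then show "smooth_real (deriv f)"
    using assms unfolding smooth_real_def by metis
qed

lemma smooth_real_prim:
  assumes "smooth_real f" "\<And>x. (F has_field_derivative f x) (at x)"
  shows "smooth_real F"
proof (rule smooth_realI[of _ "insert F {f. smooth_real f}"])
  fix g assume "g \<in> insert F {f. smooth_real f}"
  then show "\<exists>g'\<in>insert F {f. smooth_real f}. \<forall>x. (g has_field_derivative g' x) (at x)"
    using assms smooth_real_has_deriv by blast
qed simp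

lemma smooth_real_lincomb:
  assumes "smooth_real f" "smooth_real g"
  shows "smooth_real (\<lambda>x. f x + c * g x)"
proof (rule smooth_realI[of _ "{\<lambda>x. f x + c * g x |f g. smooth_real f \<and> smooth_real g}"])
  fix h assume "h \<in> {\<lambda>x. f x + c * g x |f g. smooth_real f \<and> smooth_real g}"
  then obtain f g where "h = (\<lambda>x. f x + c * g x)" "smooth_real f" "smooth_real g"
    by blast
  then show "\<exists>h'\<in>{\<lambda>x. f x + c * g x |f g. smooth_real f \<and> smooth_real g}.
               \<forall>x. (h has_field_derivative h' x) (at x)"
    by (intro bexI[of _ "\<lambda>x. deriv f x + c * deriv g x"])
       (auto intro!: derivative_eq_intros smooth_real_has_deriv)
qed (use assms in blast)

text \<open>
  Scaling the argument by \<open>k + 1\<close> amounts to taking the \<open>(k + 1)\<close>-th root of \<open>exp (- 1/x)\<close>, which tends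
  to \<open>1\<close> wherever \<open>x > 0\<close>. So these functions approximate the indicator of an open interval from
  below, with a fixed support and without any normalisation.
\<close>

definition bump :: "real \<Rightarrow> real \<Rightarrow> nat \<Rightarrow> real \<Rightarrow> real" where
  "bump a b k x = flat 0 (real (Suc k) * (x - a)) * flat 0 (real (Suc k) * (b - x))"

lemma flat_0_bounds: "0 \<le> flat 0 x" "flat 0 x \<le> 1"
  by (auto simp: flat_def)

lemma bump_bounds: "0 \<le> bump a b k x" "bump a b k x \<le> 1"
  unfolding bump_def using flat_0_bounds by (auto intro: mult_le_one)

lemma bump_outside: "x \<notin> {a<..<b} \<Longrightarrow> bump a b k x = 0"
  by (auto simp: bump_def flat_def zero_less_mult_iff)

lemma bump_pos: "x \<in> {a<..<b} \<Longrightarrow> bump a b k x > 0"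
  by (auto simp: bump_def flat_def zero_less_mult_iff)

lemma smooth_bump: "smooth_real (bump a b k)"
proof (rule smooth_realI[of _ flat_products])
  show "bump a b k \<in> flat_products"
    using flat_products.product[of 1 0 "real (Suc k)" a 0 b] by (simp add: bump_def[abs_def])
qed (rule flat_products_deriv)

lemma test_functions_iff:
  "\<eta> \<in> test_functions \<longleftrightarrow> smooth_real \<eta> \<and> (\<exists>a b. 0 < a \<and> b < pi \<and> (\<forall>x. x \<notin> {a..b} \<longrightarrow> \<eta> x = 0))"
  by (simp add: test_functions_def smooth_real_def)

lemma bump_test_function: "0 < a \<Longrightarrow> b < pi \<Longrightarrow> bump a b k \<in> test_functions"
  using smooth_bump bump_outside[of _ a b k]
  unfolding test_functions_iff by (metis greaterThanLessThan_subseteq_atLeastAtMost_iff order_refl subsetD)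

lemma flat_0_tendsto: "x > 0 \<Longrightarrow> (\<lambda>k. flat 0 (real (Suc k) * x)) \<longlonglongrightarrow> 1"
proof -
  assume x: "x > 0"
  have "(\<lambda>k. exp (- (inverse (real (Suc k)) * (1/x)))) \<longlonglongrightarrow> exp (- (0 * (1/x)))"
    by (intro tendsto_intros LIMSEQ_inverse_real_of_nat)
  moreover have "flat 0 (real (Suc k) * x) = exp (- (inverse (real (Suc k)) * (1/x)))" for k
    using x by (auto simp: flat_def zero_less_mult_iff field_simps add_pos_nonneg)
  ultimately show ?thesis by simp
qed

lemma bump_tendsto_indicator: "(\<lambda>k. bump a b k x) \<longlonglongrightarrow> indicator {a<..<b} x"
proof (cases "x \<in> {a<..<b}")
  case True
  then have "(\<lambda>k. bump a b k x) \<longlonglongrightarrow> 1 * 1"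
    unfolding bump_def by (intro tendsto_mult flat_0_tendsto) auto
  with True show ?thesis by simp
qed (simp add: bump_outside)

section \<open>The fundamental lemma of the calculus of variations\<close>

abbreviation M where "M \<equiv> lebesgue_on I0pi"

text \<open>
  Intervals generate the Borel sets, so the integral over every Borel set vanishes; a Borel
  representative replaces the Lebesgue measurable function first.
\<close>

lemma AE_zero_if_interval_integrals_zero_real:
  fixes h :: "real \<Rightarrow> real"
  assumes h: "integrable lebesgue h"
    and zero: "\<And>a b. (LINT x|lebesgue. indicator {a<..<b} x * h x) = 0"
  shows "AE x in lebesgue. h x = 0"
proof -
  obtain h' where h'[measurable]: "h' \<in> borel_measurable lborel" and "AE x in lborel. h x = h' x"
    using completion_ex_borel_measurable_real[of h lborel] h by auto
  then have eq: "AE x in lebesgue. h x = h' x"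
    by (auto intro: AE_completion)
  have h'm: "h' \<in> borel_measurable lebesgue"
    using h' by (rule measurable_completion)
  have "integrable lebesgue h'"
    using integrable_cong_AE[OF _ h'm eq] h by auto
  then have int: "integrable lborel h'"
    using integrable_completion[OF h'] by simp
  then have sint: "set_integrable lborel A h'" if "A \<in> sets borel" for A
    unfolding set_integrable_def using that by (intro integrable_mult_indicator) auto
  have ivl: "(LINT x:{a..b}|lborel. h' x) = 0" for a b
  proof -
    have "(LINT x|lborel. indicator {a..b} x * h' x) = (LINT x|lebesgue. indicator {a..b} x * h' x)"
      by (rule integral_completion[symmetric]) auto
    also have "\<dots> = (LINT x|lebesgue. indicator {a<..<b} x * h x)"
    proof (rule integral_cong_AE)
      have "AE x in lebesgue. x \<noteq> a \<and> x \<noteq> b"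
        using AE_completion[OF AE_lborel_singleton[of a]] AE_completion[OF AE_lborel_singleton[of b]]
        by auto
      with eq show "AE x in lebesgue. indicator {a..b} x * h' x = indicator {a<..<b} x * h x"
        by eventually_elim (auto simp: indicator_def)
    qed (use h h'm in \<open>auto intro!: borel_measurable_times borel_measurable_indicator\<close>)
    finally show ?thesis
      using zero by (simp add: set_lebesgue_integral_def)
  qed
  \<comment> \<open>Complements need the integral over the whole line: a limit over growing intervals.\<close>
  have total: "(LINT x|lborel. h' x) = 0"
  proof -
    have "(\<lambda>n. LINT x|lborel. indicator {- real n..real n} x * h' x) \<longlonglongrightarrow> (LINT x|lborel. h' x)"
    proof (rule integral_dominated_convergence[where w="\<lambda>x. norm (h' x)"])
      show "AE x in lborel. (\<lambda>n. indicator {- real n..real n} x * h' x) \<longlonglongrightarrow> h' x"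
      proof (rule AE_I2, rule tendsto_eventually)
        fix x :: real
        obtain m where "\<bar>x\<bar> \<le> real m" using real_arch_simple by blast
        then show "\<forall>\<^sub>F n in sequentially. indicator {- real n..real n} x * h' x = h' x"
          by (auto simp: eventually_sequentially indicator_def intro!: exI[of _ m])
      qed
    qed (use int in \<open>auto simp: indicator_def\<close>)
    then show ?thesis
      using ivl by (simp add: set_lebesgue_integral_def LIMSEQ_const_iff)
  qed
  have "(LINT x:A|lborel. h' x) = 0" if "A \<in> sets borel" for A
    using that
  proof (induction A rule: borel_set_induct)
    case (compl A)
    have "(LINT x:A \<union> - A|lborel. h' x) = (LINT x:A|lborel. h' x) + (LINT x:- A|lborel. h' x)"
      using compl by (intro set_integral_Un sint) auto
    then show ?case
      using compl total by (simp add: set_lebesgue_integral_def)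
  next
    case (union f)
    then show ?case
      by (subst lebesgue_integral_countable_add) (auto intro!: sint simp: disjoint_family_on_def)
  qed (use ivl in \<open>auto simp: set_lebesgue_integral_def\<close>)
  then have "AE x in lborel. h' x = 0"
    using density_unique_real[of lborel h' "\<lambda>_. 0"] int by (simp add: set_lebesgue_integral_def)
  then have "AE x in lebesgue. h' x = 0"
    by (rule AE_completion)
  with eq show ?thesis by eventually_elim simp
qed

lemma AE_zero_if_interval_integrals_zero:
  fixes h :: "real \<Rightarrow> complex"
  assumes h: "integrable lebesgue h"
    and zero: "\<And>a b. (LINT x|lebesgue. indicator {a<..<b} x *\<^sub>R h x) = 0"
  shows "AE x in lebesgue. h x = 0"
proof -
  have int: "integrable lebesgue (\<lambda>x. indicator {a<..<b} x *\<^sub>R h x)" for a b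
    using h by (intro integrable_mult_indicator) auto
  have "(LINT x|lebesgue. indicator {a<..<b} x * Re (h x)) = 0"
       "(LINT x|lebesgue. indicator {a<..<b} x * Im (h x)) = 0" for a b
    using integral_bounded_linear[OF bounded_linear_Re int, of a b]
      integral_bounded_linear[OF bounded_linear_Im int, of a b] zero by simp_all
  then have "AE x in lebesgue. Re (h x) = 0" "AE x in lebesgue. Im (h x) = 0"
    using h by (intro AE_zero_if_interval_integrals_zero_real integrable_Re integrable_Im; simp)+
  then show ?thesis
    by eventually_elim (simp add: complex_eq_iff)
qed

lemma ident_measurable_M [measurable]: "(\<lambda>x. x) \<in> borel_measurable M"
  using id_borel_measurable_lebesgue_on by (simp add: id_def)

lemma AE_M_iff: "(AE x in M. P x) \<longleftrightarrow> (AE x in lebesgue. x \<in> I0pi \<longrightarrow> P x)"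
  by (rule AE_restrict_space_iff) simp

lemma integral_M_indicator:
  fixes f :: "real \<Rightarrow> 'a::euclidean_space"
  assumes "A \<subseteq> I0pi" "A \<in> sets lebesgue"
  shows "(LINT x|M. indicator A x *\<^sub>R f x) = (LINT x|lebesgue_on A. f x)"
    and "integrable M (\<lambda>x. indicator A x *\<^sub>R f x) \<longleftrightarrow> integrable (lebesgue_on A) f"
proof -
  have eq: "(\<lambda>x. indicator I0pi x *\<^sub>R indicator A x *\<^sub>R f x) = (\<lambda>x. indicator A x *\<^sub>R f x)"
    using assms(1) by (auto simp: indicator_def fun_eq_iff)
  have A: "A \<inter> space lebesgue \<in> sets lebesgue" and I: "I0pi \<inter> space lebesgue \<in> sets lebesgue"
    using assms(2) by auto
  show "(LINT x|M. indicator A x *\<^sub>R f x) = (LINT x|lebesgue_on A. f x)"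
    "integrable M (\<lambda>x. indicator A x *\<^sub>R f x) \<longleftrightarrow> integrable (lebesgue_on A) f"
    by (simp_all only: integral_restrict_space[OF A] integral_restrict_space[OF I]
          integrable_restrict_space[OF A] integrable_restrict_space[OF I] eq)
qed

lemma measurable_M_continuous:
  fixes f :: "real \<Rightarrow> 'a::euclidean_space"
  assumes "continuous_on I0pi f"
  shows "f \<in> borel_measurable M"
  using assms by (intro continuous_imp_measurable_on_sets_lebesgue) auto

lemma integrable_M_continuous:
  fixes f :: "real \<Rightarrow> 'a::euclidean_space"
  assumes "continuous_on {0..pi} f"
  shows "integrable M f"
proof -
  have "set_integrable lebesgue {0..pi} f"
    using continuous_imp_integrable_real[OF assms] by (simp add: set_integrable_def integrable_restrict_space)
  then have "set_integrable lebesgue I0pi f"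
    by (rule set_integrable_subset) auto
  then show ?thesis
    by (simp add: set_integrable_def integrable_restrict_space)
qed

text \<open>
  Lets locally integrable functions be paired with test functions and with indicators of intervals.
\<close>

lemma L1_loc_bounded_mult_integrable:
  fixes \<eta> :: "real \<Rightarrow> real"
  assumes f: "f \<in> L1_loc" and ab: "0 < a" "b < pi"
    and \<eta>: "\<eta> \<in> borel_measurable M" "\<And>x. \<bar>\<eta> x\<bar> \<le> B" "\<And>x. x \<notin> {a..b} \<Longrightarrow> \<eta> x = 0"
  shows "integrable M (\<lambda>x. f x * of_real (\<eta> x))"
proof (rule Bochner_Integration.integrable_bound)
  have "integrable M (\<lambda>x. indicator {a..b} x *\<^sub>R f x)"
    using f ab by (subst integral_M_indicator) (auto simp: L1_loc_def)
  then show "integrable M (\<lambda>x. B * norm (indicator {a..b} x *\<^sub>R f x))"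
    by (intro integrable_mult_right integrable_norm)
  have [measurable]: "f \<in> borel_measurable M" using f by (simp add: L1_loc_def)
  note \<eta>(1)[measurable]
  show "(\<lambda>x. f x * of_real (\<eta> x)) \<in> borel_measurable M" by measurable
  have "0 \<le> B" using \<eta>(2)[of 0] by linarith
  then show "AE x in M. norm (f x * of_real (\<eta> x)) \<le> norm (B * norm (indicator {a..b} x *\<^sub>R f x))"
  proof (intro AE_I2)
    fix x show "norm (f x * of_real (\<eta> x)) \<le> norm (B * norm (indicator {a..b} x *\<^sub>R f x))"
      using \<eta>(2)[of x] \<eta>(3)[of x] \<open>0 \<le> B\<close>
      by (cases "x \<in> {a..b}") (auto simp: norm_mult mult.commute[of B] intro!: mult_left_mono)
  qed
qed

text \<open>
  Testing against the bumps and passing to the limit shows that the integral over each compactly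
  contained interval vanishes.
\<close>

lemma fundamental_lemma_calculus_of_variations:
  assumes h: "h \<in> L1_loc"
    and zero: "\<And>\<eta>. \<eta> \<in> test_functions \<Longrightarrow> (LINT x|M. h x * of_real (\<eta> x)) = 0"
  shows "AE x in M. h x = 0"
proof -
  have hm[measurable]: "h \<in> borel_measurable M" using h by (simp add: L1_loc_def)
  have bump_m: "bump c d k \<in> borel_measurable M" for c d k
    by (rule measurable_M_continuous)
       (meson smooth_bump smooth_real_has_deriv(1) DERIV_isCont continuous_at_imp_continuous_on)
  have ivl: "(LINT x|M. indicator {c<..<d} x *\<^sub>R h x) = 0" if "0 < c" "d < pi" for c d
  proof -
    have "(\<lambda>k. LINT x|M. h x * of_real (bump c d k x)) \<longlonglongrightarrow> (LINT x|M. indicator {c<..<d} x *\<^sub>R h x)"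
    proof (rule integral_dominated_convergence[where w="\<lambda>x. norm (indicator {c..d} x *\<^sub>R h x)"])
      show "integrable M (\<lambda>x. norm (indicator {c..d} x *\<^sub>R h x))"
        using h that by (intro integrable_norm, subst integral_M_indicator) (auto simp: L1_loc_def)
      show "(\<lambda>x. indicator {c<..<d} x *\<^sub>R h x) \<in> borel_measurable M" by measurable
      show "(\<lambda>x. h x * of_real (bump c d k x)) \<in> borel_measurable M" for k
        using bump_m[of c d k] by measurable
      have "(\<lambda>k. h x * of_real (bump c d k x)) \<longlonglongrightarrow> h x * of_real (indicator {c<..<d} x)" for x
        by (intro tendsto_intros bump_tendsto_indicator)
      then show "AE x in M. (\<lambda>k. h x * of_real (bump c d k x)) \<longlonglongrightarrow> indicator {c<..<d} x *\<^sub>R h x"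
        by (auto simp: scaleR_conv_of_real mult.commute)
      show "AE x in M. norm (h x * of_real (bump c d k x)) \<le> norm (indicator {c..d} x *\<^sub>R h x)" for k
      proof (rule AE_I2)
        fix x show "norm (h x * of_real (bump c d k x)) \<le> norm (indicator {c..d} x *\<^sub>R h x)"
          using bump_bounds[of c d k x] bump_outside[of x c d k]
          by (cases "x \<in> {c<..<d}") (auto simp: norm_mult mult_left_le)
      qed
    qed
    moreover have "(LINT x|M. h x * of_real (bump c d k x)) = 0" for k
      using that by (intro zero bump_test_function)
    ultimately show ?thesis
      by (simp add: LIMSEQ_const_iff)
  qed
  \<comment> \<open>The previous step covers intervals inside \<open>(0, \<pi>)\<close>; cutting off to \<open>(a, b)\<close> extends it to all intervals.\<close>
  have loc: "AE x in lebesgue. x \<in> {a<..<b} \<longrightarrow> h x = 0" if ab: "0 < a" "b < pi" for a b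
  proof -
    have "integrable M (\<lambda>x. h x * of_real (indicator {a<..<b} x))"
      by (rule L1_loc_bounded_mult_integrable[OF h ab, where B=1]) (auto simp: indicator_def)
    then have "integrable M (\<lambda>x. indicator {a<..<b} x *\<^sub>R h x)"
      by (simp add: scaleR_conv_of_real mult.commute)
    then have "integrable lebesgue (\<lambda>x. indicator I0pi x *\<^sub>R indicator {a<..<b} x *\<^sub>R h x)"
      by (subst (asm) integrable_restrict_space) auto
    moreover have "(LINT x|lebesgue. indicator {c<..<d} x *\<^sub>R indicator I0pi x *\<^sub>R indicator {a<..<b} x *\<^sub>R h x) = 0" for c d
    proof -
      have "(LINT x|lebesgue. indicator {c<..<d} x *\<^sub>R indicator I0pi x *\<^sub>R indicator {a<..<b} x *\<^sub>R h x)
          = (LINT x|lebesgue. indicator I0pi x *\<^sub>R indicator {max a c<..<min b d} x *\<^sub>R h x)"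
        by (rule Bochner_Integration.integral_cong) (auto simp: indicator_def)
      also have "\<dots> = (LINT x|M. indicator {max a c<..<min b d} x *\<^sub>R h x)"
        by (subst integral_restrict_space) auto
      finally show ?thesis using ivl ab by auto
    qed
    ultimately have "AE x in lebesgue. indicator I0pi x *\<^sub>R indicator {a<..<b} x *\<^sub>R h x = 0"
      by (rule AE_zero_if_interval_integrals_zero)
    then show ?thesis
      by (rule AE_mp) (use ab in \<open>auto simp: indicator_def intro!: AE_I2\<close>)
  qed
  have "AE x in lebesgue. \<forall>n. x \<in> {inverse (real (Suc n))<..<pi - inverse (real (Suc n))} \<longrightarrow> h x = 0"
    unfolding AE_all_countable by (intro allI loc) auto
  then show ?thesis
    unfolding AE_M_iff
  proof eventually_elim
    case (elim x)
    show ?case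
    proof
      assume "x \<in> I0pi"
      then have "0 < min x (pi - x)" by simp
      then obtain n where "inverse (real (Suc n)) < min x (pi - x)"
        using reals_Archimedean by blast
      then show "h x = 0" using elim by auto
    qed
  qed
qed

section \<open>Weak derivatives and primitives\<close>

interpretation M: finite_measure M
  by (rule finite_measure_lebesgue_on) simp

interpretation MM: pair_sigma_finite M M ..

text \<open>
  The variable limit is put into an indicator, with one measure space for both variables, so that
  Fubini's theorem applies on a product of finite measures.
\<close>

definition primitive :: "(real \<Rightarrow> complex) \<Rightarrow> real \<Rightarrow> complex" where
  "primitive g x = (LINT t|M. indicator {..<x} t *\<^sub>R g t)"

lemma continuous_on_Icc_bounded:
  fixes w :: "real \<Rightarrow> real"
  assumes "continuous_on {a..b} w"
  shows "\<exists>B. \<forall>x\<in>{a..b}. \<bar>w x\<bar> \<le> B"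
  using compact_imp_bounded[OF compact_continuous_image[OF assms compact_Icc]]
  by (auto simp: bounded_iff)

lemma primitive_0 [simp]: "primitive g 0 = 0"
proof -
  have "primitive g 0 = (LINT t|M. 0)"
    unfolding primitive_def by (rule Bochner_Integration.integral_cong) (auto simp: indicator_def)
  then show ?thesis by simp
qed

lemma primitive_pi: "primitive g pi = (LINT t|M. g t)"
  unfolding primitive_def by (rule Bochner_Integration.integral_cong) (auto simp: indicator_def)

lemma continuous_on_primitive:
  assumes g: "integrable M g"
  shows "continuous_on {0..pi} (primitive g)"
proof -
  have "g integrable_on {0<..<pi}"
    using g by (intro integrable_on_lebesgue_on) auto
  then have int: "g integrable_on {0..pi}"
    by (simp add: integrable_on_Icc_iff_Ioo)
  have "primitive g x = integral {0..x} g" if x: "x \<in> {0..pi}" for x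
  proof -
    have "primitive g x = (LINT t|M. indicator {0<..<x} t *\<^sub>R g t)"
      unfolding primitive_def by (rule Bochner_Integration.integral_cong) (auto simp: indicator_def)
    also have "\<dots> = (LINT t|lebesgue_on {0<..<x}. g t)"
      using x by (intro integral_M_indicator) auto
    also have "\<dots> = integral {0<..<x} g"
    proof (rule lebesgue_integral_eq_integral)
      have "integrable M (\<lambda>t. indicator {0<..<x} t *\<^sub>R g t)"
        using x by (intro integrable_mult_indicator g) (auto simp: sets_restrict_space image_iff intro!: bexI[of _ "{0<..<x}"])
      then show "integrable (lebesgue_on {0<..<x}) g"
        using x by (subst (asm) integral_M_indicator) auto
    qed auto
    finally show ?thesis by (simp add: integral_open_interval_real)
  qed
  then show ?thesis
    using indefinite_integral_continuous_1[OF int] by (metis (no_types, lifting) continuous_on_cong)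
qed

lemma primitive_measurable:
  assumes "integrable M g" shows "primitive g \<in> borel_measurable M"
  by (rule measurable_M_continuous, rule continuous_on_subset[OF continuous_on_primitive[OF assms]]) auto

lemma primitive_lincomb:
  assumes "integrable M g" "integrable M h"
  shows "primitive (\<lambda>x. g x + c * h x) x = primitive g x + c * primitive h x"
proof -
  have "{..<x} \<inter> I0pi \<in> sets M"
    by (auto simp: sets_restrict_space image_iff intro!: bexI[of _ "{..<x}"])
  then have int: "integrable M (\<lambda>t. indicator ({..<x} \<inter> I0pi) t *\<^sub>R u t)" if "integrable M u" for u :: "real \<Rightarrow> complex"
    using that by (rule integrable_mult_indicator)
  have eq: "primitive u x = (LINT t|M. indicator ({..<x} \<inter> I0pi) t *\<^sub>R u t)" for u
    unfolding primitive_def by (rule Bochner_Integration.integral_cong) (auto simp: indicator_def)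
  have "primitive (\<lambda>x. g x + c * h x) x =
     (LINT t|M. indicator ({..<x} \<inter> I0pi) t *\<^sub>R g t + c * (indicator ({..<x} \<inter> I0pi) t *\<^sub>R h t))"
    unfolding eq by (rule Bochner_Integration.integral_cong) (auto simp: scaleR_right_distrib)
  also have "\<dots> = primitive g x + c * primitive h x"
    unfolding eq integral_mult_right_zero[symmetric]
    by (intro Bochner_Integration.integral_add int assms integrable_mult_right)
  finally show ?thesis .
qed

lemma integral_derivative_tail:
  fixes w w' :: "real \<Rightarrow> real"
  assumes w: "continuous_on {0..pi} w" "\<And>x. x \<in> I0pi \<Longrightarrow> (w has_real_derivative w' x) (at x)"
    and w': "continuous_on {0..pi} w'" and t: "t \<in> {0..pi}"
  shows "(LINT x|M. indicator {t<..} x * w' x) = w pi - w t"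
proof -
  have "(LINT x|M. indicator {t<..} x * w' x) = (LINT x|M. indicator {t<..<pi} x *\<^sub>R w' x)"
    by (rule Bochner_Integration.integral_cong) (auto simp: indicator_def)
  also have "\<dots> = (LINT x|lebesgue_on {t<..<pi}. w' x)"
    using t by (intro integral_M_indicator) auto
  also have "\<dots> = integral {t<..<pi} w'"
  proof (rule lebesgue_integral_eq_integral)
    have "integrable M (\<lambda>x. indicator {t<..<pi} x *\<^sub>R w' x)"
      using t by (intro integrable_mult_indicator integrable_M_continuous w')
        (auto simp: sets_restrict_space image_iff intro!: bexI[of _ "{t<..<pi}"])
    then show "integrable (lebesgue_on {t<..<pi}) w'"
      using t by (subst (asm) integral_M_indicator) auto
  qed auto
  also have "\<dots> = w pi - w t"
  proof -
    have "(w' has_integral (w pi - w t)) {t..pi}"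
      using t by (intro fundamental_theorem_of_calculus_interior continuous_on_subset[OF w(1)])
        (auto intro!: w(2) simp: has_real_derivative_iff_has_vector_derivative[symmetric])
    then show ?thesis by (simp add: integral_open_interval_real[symmetric] integral_unique)
  qed
  finally show ?thesis .
qed

text \<open>
  Inserting the definition of the primitive and exchanging the order of integration, the inner
  integral of \<open>w'\<close> over \<open>(t, \<pi>)\<close> is \<open>w \<pi> - w t\<close>. The derivative of \<open>w\<close> is taken in the
  open interval only, since \<open>w\<close> will contain the factor \<open>omega\<close>, whose slope is infinite at the endpoints.
\<close>

lemma integration_by_parts_primitive:
  fixes w w' :: "real \<Rightarrow> real"
  assumes g: "integrable M g"
    and w: "continuous_on {0..pi} w" "\<And>x. x \<in> I0pi \<Longrightarrow> (w has_real_derivative w' x) (at x)"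
    and w': "continuous_on {0..pi} w'"
  shows "(LINT x|M. primitive g x * of_real (w' x))
           = primitive g pi * of_real (w pi) - (LINT x|M. g x * of_real (w x))"
proof -
  have gm[measurable]: "g \<in> borel_measurable M" using g by simp
  have wm'[measurable]: "w' \<in> borel_measurable M"
    using w' by (intro measurable_M_continuous) (rule continuous_on_subset, auto)
  obtain B where B: "\<And>x. x \<in> {0..pi} \<Longrightarrow> \<bar>w' x\<bar> \<le> B"
    using continuous_on_Icc_bounded[OF w'] by blast
  then have "0 \<le> B" using B[of 0] by fastforce
  \<comment> \<open>The double integrand on the triangle \<open>t < x\<close>.\<close>
  define k where "k = (\<lambda>(t, x). indicator {(t, x). t < x} (t, x) *\<^sub>R (g t * of_real (w' x)))"
  have km[measurable]: "k \<in> borel_measurable (M \<Otimes>\<^sub>M M)"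
  proof -
    have [measurable]: "fst \<in> borel_measurable (M \<Otimes>\<^sub>M M)" "snd \<in> borel_measurable (M \<Otimes>\<^sub>M M)"
      using measurable_compose[OF measurable_fst ident_measurable_M]
        measurable_compose[OF measurable_snd ident_measurable_M] by simp_all
    have "k = (\<lambda>p. if fst p < snd p then g (fst p) * of_real (w' (snd p)) else 0)"
      by (auto simp: k_def fun_eq_iff)
    then show ?thesis by simp
  qed
  have bound: "norm (k (t, x)) \<le> norm (g t) * B" if "x \<in> I0pi" for t x
    using B[of x] that \<open>0 \<le> B\<close> by (auto simp: k_def norm_mult indicator_def intro!: mult_left_mono)
  have kt: "(\<lambda>x. k (t, x)) \<in> borel_measurable M" for t
  proof -
    have "(\<lambda>x. k (t, x)) = (\<lambda>x. if t < x then g t * of_real (w' x) else 0)"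
      by (auto simp: k_def fun_eq_iff)
    then show ?thesis by simp
  qed
  have kint: "integrable M (\<lambda>x. k (t, x))" for t
    by (rule M.integrable_const_bound[where B="norm (g t) * B"]) (auto intro!: AE_I2 bound kt)
  have int: "integrable (M \<Otimes>\<^sub>M M) k"
  proof (rule MM.Fubini_integrable)
    show "integrable M (\<lambda>t. LINT x|M. norm (k (t, x)))"
    proof (rule Bochner_Integration.integrable_bound)
      show "integrable M (\<lambda>t. norm (g t) * B * measure M I0pi)"
        using g by (intro integrable_mult_left integrable_norm)
      show "AE t in M. norm (LINT x|M. norm (k (t, x))) \<le> norm (norm (g t) * B * measure M I0pi)"
      proof (rule AE_I2)
        fix t
        have "(LINT x|M. norm (k (t, x))) \<le> (LINT x|M. norm (g t) * B)"
          using kint bound by (intro integral_mono) auto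
        moreover have "0 \<le> (LINT x|M. norm (k (t, x)))" by simp
        ultimately show "norm (LINT x|M. norm (k (t, x))) \<le> norm (norm (g t) * B * measure M I0pi)"
          using \<open>0 \<le> B\<close> by (simp add: mult_ac)
      qed
      show "(\<lambda>t. LINT x|M. norm (k (t, x))) \<in> borel_measurable M"
        by (rule M.borel_measurable_lebesgue_integral) simp
    qed
  qed (use kint in auto)
  have "(LINT x|M. primitive g x * of_real (w' x)) = (LINT x|M. LINT t|M. k (t, x))"
  proof (rule Bochner_Integration.integral_cong)
    fix x
    have "primitive g x * of_real (w' x) = (LINT t|M. indicator {..<x} t *\<^sub>R g t * of_real (w' x))"
      unfolding primitive_def by (rule integral_mult_left_zero[symmetric])
    also have "\<dots> = (LINT t|M. k (t, x))"
      unfolding k_def by (rule Bochner_Integration.integral_cong) (auto simp: indicator_def)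
    finally show "primitive g x * of_real (w' x) = (LINT t|M. k (t, x))" .
  qed simp
  also have "\<dots> = (LINT t|M. LINT x|M. k (t, x))"
    using MM.Fubini_integral[of "\<lambda>t x. k (t, x)"] int by simp
  also have "\<dots> = (LINT t|M. g t * of_real (w pi) - g t * of_real (w t))"
  proof (rule Bochner_Integration.integral_cong)
    fix t assume "t \<in> space M"
    have "(LINT x|M. k (t, x)) = (LINT x|M. g t * of_real (indicator {t<..} x * w' x))"
      unfolding k_def by (rule Bochner_Integration.integral_cong) (auto simp: indicator_def)
    also have "\<dots> = g t * of_real (LINT x|M. indicator {t<..} x * w' x)"
      by (simp only: integral_mult_right_zero integral_complex_of_real)
    also have "(LINT x|M. indicator {t<..} x * w' x) = w pi - w t"
      using \<open>t \<in> space M\<close> by (intro integral_derivative_tail w w') auto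
    finally show "(LINT x|M. k (t, x)) = g t * of_real (w pi) - g t * of_real (w t)"
      by (simp add: algebra_simps)
  qed simp
  also have "\<dots> = (LINT t|M. g t * of_real (w pi)) - (LINT t|M. g t * of_real (w t))"
  proof (rule Bochner_Integration.integral_diff)
    obtain C where C: "\<And>x. x \<in> {0..pi} \<Longrightarrow> \<bar>w x\<bar> \<le> C"
      using continuous_on_Icc_bounded[OF w(1)] by blast
    have wm[measurable]: "w \<in> borel_measurable M"
      using w(1) by (intro measurable_M_continuous) (rule continuous_on_subset, auto)
    show "integrable M (\<lambda>t. g t * of_real (w t))"
    proof (rule Bochner_Integration.integrable_bound)
      show "integrable M (\<lambda>t. norm (g t) * C)"
        using g by (intro integrable_mult_left integrable_norm)
      show "AE t in M. norm (g t * of_real (w t)) \<le> norm (norm (g t) * C)"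
      proof (rule AE_I2)
        fix t assume "t \<in> space M"
        then have "\<bar>w t\<bar> \<le> \<bar>C\<bar>" using C[of t] by auto
        then show "norm (g t * of_real (w t)) \<le> norm (norm (g t) * C)"
          by (simp add: norm_mult abs_mult mult_left_mono)
      qed
    qed measurable
  qed (use g in auto)
  finally show ?thesis by (simp add: primitive_pi)
qed

text \<open>
  Absolute continuity on the closed interval, up to a null set, with initial value \<open>c\<close> and derivative
  \<open>g\<close>. All later statements about the form domain are made for such triples.
\<close>

definition is_primitive :: "complex \<Rightarrow> (real \<Rightarrow> complex) \<Rightarrow> (real \<Rightarrow> complex) \<Rightarrow> bool" where
  "is_primitive c g f \<longleftrightarrow> integrable M g \<and> f \<in> borel_measurable M \<and> (AE x in M. f x = c + primitive g x)"

lemma is_primitive_lincomb: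
  assumes "is_primitive a g f" "is_primitive b k h"
  shows "is_primitive (a + c * b) (\<lambda>x. g x + c * k x) (\<lambda>x. f x + c * h x)"
proof -
  have int: "integrable M g" "integrable M k"
    and "AE x in M. f x = a + primitive g x" "AE x in M. h x = b + primitive k x"
    using assms by (auto simp: is_primitive_def)
  from this(3,4) have "AE x in M. f x + c * h x = (a + c * b) + primitive (\<lambda>x. g x + c * k x) x"
    by eventually_elim (simp add: primitive_lincomb[OF int] algebra_simps)
  then show ?thesis
    using assms by (auto simp: is_primitive_def)
qed

lemma integrable_M_imp_L1_loc:
  assumes "integrable M f" shows "f \<in> L1_loc"
proof -
  have "integrable (lebesgue_on {a..b}) f" if "0 < a" "b < pi" for a b
  proof -
    have "integrable M (\<lambda>x. indicator {a..b} x *\<^sub>R f x)"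
      using that by (intro integrable_mult_indicator assms)
        (auto simp: sets_restrict_space image_iff intro!: bexI[of _ "{a..b}"])
    then show ?thesis
      using that by (subst (asm) integral_M_indicator) auto
  qed
  then show ?thesis
    using assms by (auto simp: L1_loc_def)
qed

lemma is_primitive_integrable:
  assumes "is_primitive c g f" shows "integrable M f"
proof -
  have g: "integrable M g" using assms by (simp add: is_primitive_def)
  have "integrable M (\<lambda>x. c + primitive g x)"
    by (intro integrable_M_continuous continuous_intros continuous_on_primitive g)
  then show ?thesis
    using assms by (subst integrable_cong_AE[of f M "\<lambda>x. c + primitive g x"]) (auto simp: is_primitive_def)
qed

lemma is_primitive_by_parts:
  fixes w w' :: "real \<Rightarrow> real"
  assumes f: "is_primitive c g f"
    and w: "continuous_on {0..pi} w" "\<And>x. x \<in> I0pi \<Longrightarrow> (w has_real_derivative w' x) (at x)"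
    and w': "continuous_on {0..pi} w'"
  shows "(LINT x|M. f x * of_real (w' x))
           = (c + primitive g pi) * of_real (w pi) - c * of_real (w 0) - (LINT x|M. g x * of_real (w x))"
proof -
  have g: "integrable M g" and fm: "f \<in> borel_measurable M"
    and eq: "AE x in M. f x = c + primitive g x" using f by (auto simp: is_primitive_def)
  have wm'[measurable]: "w' \<in> borel_measurable M"
    using w' by (intro measurable_M_continuous) (rule continuous_on_subset, auto)
  note [measurable] = fm primitive_measurable[OF g]
  have "(LINT x|M. f x * of_real (w' x)) = (LINT x|M. c * of_real (w' x) + primitive g x * of_real (w' x))"
  proof (rule integral_cong_AE)
    show "AE x in M. f x * of_real (w' x) = c * of_real (w' x) + primitive g x * of_real (w' x)"
      using eq by eventually_elim (simp add: algebra_simps)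
  qed measurable
  also have "\<dots> = (LINT x|M. c * of_real (w' x)) + (LINT x|M. primitive g x * of_real (w' x))"
    by (rule Bochner_Integration.integral_add)
       (intro integrable_M_continuous continuous_intros continuous_on_primitive g w')+
  also have "(LINT x|M. c * of_real (w' x)) = c * of_real (LINT x|M. w' x)"
    by (simp only: integral_mult_right_zero integral_complex_of_real)
  also have "(LINT x|M. w' x) = (LINT x|M. indicator {0<..} x * w' x)"
    by (rule Bochner_Integration.integral_cong) (auto simp: indicator_def)
  also have "\<dots> = w pi - w 0"
    by (intro integral_derivative_tail w w') auto
  also have "(LINT x|M. primitive g x * of_real (w' x))
      = primitive g pi * of_real (w pi) - (LINT x|M. g x * of_real (w x))"
    by (rule integration_by_parts_primitive[OF g w w'])
  finally show ?thesis by (simp add: algebra_simps)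
qed

lemma test_functionsI:
  assumes "smooth_real \<eta>" "0 < a" "b < pi" "\<And>x. x \<notin> {a..b} \<Longrightarrow> \<eta> x = 0"
  shows "\<eta> \<in> test_functions"
  unfolding test_functions_iff using assms by meson

lemma test_function_props:
  assumes "\<eta> \<in> test_functions"
  shows "(\<eta> has_real_derivative deriv \<eta> x) (at x)" "continuous_on A \<eta>" "continuous_on A (deriv \<eta>)"
    "\<eta> 0 = 0" "\<eta> pi = 0" "deriv \<eta> \<in> test_functions"
proof -
  obtain a b where sm: "smooth_real \<eta>" and ab: "0 < a" "b < pi" "\<And>x. x \<notin> {a..b} \<Longrightarrow> \<eta> x = 0"
    using assms unfolding test_functions_iff by auto
  note d = smooth_real_has_deriv[OF sm]
  show "(\<eta> has_real_derivative deriv \<eta> x) (at x)" by (rule d)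
  show "continuous_on A \<eta>"
    by (meson d DERIV_isCont continuous_at_imp_continuous_on)
  show "continuous_on A (deriv \<eta>)"
    by (meson smooth_real_has_deriv[OF d(2)] DERIV_isCont continuous_at_imp_continuous_on)
  show "\<eta> 0 = 0" "\<eta> pi = 0" using ab by auto
  have "deriv \<eta> x = 0" if "x \<notin> {a..b}" for x
  proof -
    have "\<forall>\<^sub>F y in nhds x. \<eta> y = (\<lambda>_. 0) y"
    proof (rule eventually_mono[OF eventually_nhds_in_open[of "- {a..b}" x]])
      show "open (- {a..b})" by (rule open_Compl) simp
    qed (use that ab(3) in auto)
    then have "(\<eta> has_real_derivative 0) (at x)"
      using DERIV_cong_ev[of x x \<eta> "\<lambda>_. 0" 0 0] by simp
    then show ?thesis by (rule DERIV_imp_deriv)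
  qed
  then show "deriv \<eta> \<in> test_functions"
    unfolding test_functions_iff using d(2) ab by blast
qed

lemma L1_loc_test_integrable:
  assumes f: "f \<in> L1_loc" and \<eta>: "\<eta> \<in> test_functions"
  shows "integrable M (\<lambda>x. f x * of_real (\<eta> x))"
proof -
  obtain a b where ab: "0 < a" "b < pi" "\<And>x. x \<notin> {a..b} \<Longrightarrow> \<eta> x = 0"
    using \<eta> unfolding test_functions_iff by auto
  obtain B where B: "\<And>x. x \<in> {a..b} \<Longrightarrow> \<bar>\<eta> x\<bar> \<le> B"
    using continuous_on_Icc_bounded[OF test_function_props(2)[OF \<eta>]] by blast
  show ?thesis
  proof (rule L1_loc_bounded_mult_integrable[OF f ab(1,2), where B="max 0 B"])
    show "\<bar>\<eta> x\<bar> \<le> max 0 B" for x using B ab(3) by (cases "x \<in> {a..b}") (auto simp: max.coboundedI2)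
    show "\<eta> \<in> borel_measurable M" by (intro measurable_M_continuous test_function_props \<eta>)
    show "\<eta> x = 0" if "x \<notin> {a..b}" for x using ab(3) that .
  qed
qed

lemma L1_loc_diff: "f \<in> L1_loc \<Longrightarrow> g \<in> L1_loc \<Longrightarrow> (\<lambda>x. f x - g x) \<in> L1_loc"
  by (auto simp: L1_loc_def)

lemma is_primitive_has_weak_deriv:
  assumes "is_primitive c g f" shows "has_weak_deriv f g"
  unfolding has_weak_deriv_def
proof (intro conjI ballI)
  show "f \<in> L1_loc" using is_primitive_integrable[OF assms] by (rule integrable_M_imp_L1_loc)
  show "g \<in> L1_loc" using assms by (intro integrable_M_imp_L1_loc) (simp add: is_primitive_def)
  fix \<eta> assume "\<eta> \<in> test_functions"
  from test_function_props[OF this]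
  show "(LINT x|M. f x * of_real (deriv \<eta> x)) = - (LINT x|M. g x * of_real (\<eta> x))"
    by (subst is_primitive_by_parts[OF assms, of \<eta>]) auto
qed

lemma weak_deriv_unique:
  assumes "has_weak_deriv f g" "has_weak_deriv f h"
  shows "AE x in M. g x = h x"
proof -
  have gh: "g \<in> L1_loc" "h \<in> L1_loc" using assms by (auto simp: has_weak_deriv_def)
  have "AE x in M. g x - h x = 0"
  proof (rule fundamental_lemma_calculus_of_variations)
    fix \<eta> assume "\<eta> \<in> test_functions"
    then show "(LINT x|M. (g x - h x) * of_real (\<eta> x)) = 0"
      using assms gh by (auto simp: left_diff_distrib L1_loc_test_integrable has_weak_deriv_def)
  qed (intro L1_loc_diff gh)
  then show ?thesis by simp
qed

text \<open>
  Identifies the representative selected by the choice operator in \<open>weak_deriv\<close>.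
\<close>

lemma weak_deriv_is_primitive:
  assumes "is_primitive c g f"
  shows "AE x in M. weak_deriv f x = g x"
  using weak_deriv_unique[OF _ is_primitive_has_weak_deriv[OF assms]]
    someI[of "has_weak_deriv f", OF is_primitive_has_weak_deriv[OF assms]]
  unfolding weak_deriv_def by blast

text \<open>
  The vanishing integral is what makes the antiderivative vanish to the right of the support.
\<close>

lemma test_function_antiderivative:
  assumes \<zeta>: "\<zeta> \<in> test_functions" and zero: "(LINT x|M. \<zeta> x) = 0"
  shows "\<exists>Z\<in>test_functions. deriv Z = \<zeta>"
proof -
  obtain a b where sm: "smooth_real \<zeta>" and ab: "0 < a" "b < pi" "\<And>x. x \<notin> {a..b} \<Longrightarrow> \<zeta> x = 0"
    using \<zeta> unfolding test_functions_iff by auto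
  have "isCont \<zeta> x" for x by (rule DERIV_isCont[OF test_function_props(1)[OF \<zeta>]])
  then obtain F where F: "\<And>x. (F has_real_derivative \<zeta> x) (at x)"
    using einterval_antiderivative[of "-\<infinity>" "\<infinity>" \<zeta>]
    by (auto simp: has_real_derivative_iff_has_vector_derivative)
  define Z where "Z = (\<lambda>x. F x - F 0)"
  have Z: "(Z has_real_derivative \<zeta> x) (at x)" for x
    unfolding Z_def using F by (auto intro!: derivative_eq_intros)
  have const: "Z x = Z y" if "convex S" "x \<in> S" "y \<in> S" "S \<inter> {a..b} = {}" for S x y
  proof -
    have "\<And>x. x \<in> S \<Longrightarrow> (Z has_real_derivative 0) (at x within S)"
      using Z ab(3) that(4) has_field_derivative_at_within by (metis disjoint_iff)
    from has_field_derivative_zero_constant[OF that(1) this] that show ?thesis by metis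
  qed
  have "(LINT x|M. indicator {0<..} x * \<zeta> x) = Z pi - Z 0"
    by (rule integral_derivative_tail)
       (use Z DERIV_isCont[OF Z] test_function_props(2)[OF \<zeta>] in \<open>auto simp: continuous_at_imp_continuous_on\<close>)
  moreover have "(LINT x|M. indicator {0<..} x * \<zeta> x) = (LINT x|M. \<zeta> x)"
    by (rule Bochner_Integration.integral_cong) (auto simp: indicator_def)
  ultimately have "Z pi = 0" "Z 0 = 0" using zero by (auto simp: Z_def)
  then have "Z x = 0" if "x \<notin> {a..b}" for x
  proof (cases "x < a")
    case True
    have "{..<a} \<inter> {a..b} = {}" by auto
    from const[OF _ _ _ this, of x 0] True ab \<open>Z 0 = 0\<close> show ?thesis by auto
  next
    case False
    have "{b<..} \<inter> {a..b} = {}" by auto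
    from const[OF _ _ _ this, of x pi] False that ab \<open>Z pi = 0\<close> show ?thesis by auto
  qed
  moreover have "smooth_real Z" using smooth_real_prim[OF sm Z] .
  moreover have "deriv Z = \<zeta>" using Z by (auto intro!: DERIV_imp_deriv)
  ultimately show ?thesis
    using test_functionsI[of Z a b] ab(1,2) by blast
qed

lemma test_functions_lincomb:
  assumes "f \<in> test_functions" "g \<in> test_functions"
  shows "(\<lambda>x. f x + c * g x) \<in> test_functions"
proof -
  obtain a b where f: "smooth_real f" "0 < a" "b < pi" "\<And>x. x \<notin> {a..b} \<Longrightarrow> f x = 0"
    using assms unfolding test_functions_iff by auto
  obtain a' b' where g: "smooth_real g" "0 < a'" "b' < pi" "\<And>x. x \<notin> {a'..b'} \<Longrightarrow> g x = 0"
    using assms unfolding test_functions_iff by auto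
  have "f x + c * g x = 0" if "x \<notin> {min a a'..max b b'}" for x
  proof -
    have "x \<notin> {a..b}" "x \<notin> {a'..b'}" using that by auto
    then show ?thesis by (simp add: f(4) g(4))
  qed
  moreover have "0 < min a a'" "max b b' < pi" using f g by auto
  ultimately show ?thesis
    using test_functionsI[OF smooth_real_lincomb[OF f(1) g(1)]] by blast
qed

text \<open>
  Subtracting a multiple of one fixed bump from a test function makes its integral zero, hence makes
  it the derivative of a test function. So \<open>u\<close> pairs with every test function like a constant does,
  and the fundamental lemma applies to the difference.
\<close>

lemma du_Bois_Reymond:
  assumes u: "u \<in> L1_loc"
    and zero: "\<And>\<eta>. \<eta> \<in> test_functions \<Longrightarrow> (LINT x|M. u x * of_real (deriv \<eta> x)) = 0"
  shows "\<exists>c. AE x in M. u x = c"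
proof -
  have test_int: "integrable M \<eta>" if "\<eta> \<in> test_functions" for \<eta>
    by (intro integrable_M_continuous test_function_props that)
  define \<eta>0 where "\<eta>0 = bump 1 2 0"
  have \<eta>0: "\<eta>0 \<in> test_functions"
    unfolding \<eta>0_def by (rule bump_test_function) (use pi_gt3 in auto)
  define J where "J = (LINT x|M. \<eta>0 x)"
  have "J \<noteq> 0"
  proof
    assume "J = 0"
    then have "AE x in M. \<eta>0 x = 0"
      unfolding J_def
      by (subst (asm) integral_nonneg_eq_0_iff_AE)
         (use \<eta>0 in \<open>auto simp: test_int \<eta>0_def bump_bounds\<close>)
    then have "AE x in lebesgue. x \<in> I0pi \<longrightarrow> \<eta>0 x = 0"
      by (simp add: AE_M_iff)
    then have "AE x in lebesgue. x \<in> {1<..<2::real} \<longrightarrow> x \<in> {}"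
    proof eventually_elim
      case (elim x)
      then show ?case using bump_pos[of x 1 2 0] pi_gt3 by (auto simp: \<eta>0_def)
    qed
    then have "(3/2::real) \<in> {}"
      by (rule mem_closed_if_AE_lebesgue_open[rotated 2]) auto
    then show False by simp
  qed
  define c where "c = (LINT x|M. u x * of_real (\<eta>0 x)) / of_real J"
  have "AE x in M. u x - c = 0"
  proof (rule fundamental_lemma_calculus_of_variations)
    show "(\<lambda>x. u x - c) \<in> L1_loc"
      by (intro L1_loc_diff u integrable_M_imp_L1_loc) simp
    fix \<eta> assume \<eta>: "\<eta> \<in> test_functions"
    define K where "K = (LINT x|M. \<eta> x)"
    \<comment> \<open>The multiple of \<open>\<eta>0\<close> is chosen to make the integral zero.\<close>
    define \<zeta> where "\<zeta> = (\<lambda>x. \<eta> x + (- K/J) * \<eta>0 x)"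
    have "\<zeta> \<in> test_functions" unfolding \<zeta>_def by (intro test_functions_lincomb \<eta> \<eta>0)
    moreover have "(LINT x|M. \<zeta> x) = 0"
      using \<open>J \<noteq> 0\<close> unfolding \<zeta>_def
      by (subst Bochner_Integration.integral_add)
         (use test_int \<eta> \<eta>0 in \<open>auto simp: K_def[symmetric] J_def[symmetric]\<close>)
    ultimately obtain Z where "Z \<in> test_functions" "deriv Z = \<zeta>"
      using test_function_antiderivative by blast
    then have "0 = (LINT x|M. u x * of_real (\<zeta> x))" using zero[of Z] by simp
    also have "\<dots> = (LINT x|M. u x * of_real (\<eta> x) + of_real (- K/J) * (u x * of_real (\<eta>0 x)))"
      by (simp add: \<zeta>_def algebra_simps)
    also have "\<dots> = (LINT x|M. u x * of_real (\<eta> x)) + of_real (- K/J) * (LINT x|M. u x * of_real (\<eta>0 x))"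
      using L1_loc_test_integrable[OF u \<eta>] L1_loc_test_integrable[OF u \<eta>0]
      by (subst Bochner_Integration.integral_add) auto
    also have "\<dots> = (LINT x|M. u x * of_real (\<eta> x)) - c * of_real K"
      using \<open>J \<noteq> 0\<close> by (simp add: c_def)
    finally have *: "(LINT x|M. u x * of_real (\<eta> x)) = c * of_real K" by simp
    have "(LINT x|M. c * of_real (\<eta> x)) = c * of_real K"
      unfolding K_def by (simp only: integral_mult_right_zero integral_complex_of_real)
    moreover have "integrable M (\<lambda>x. c * of_real (\<eta> x))"
      using test_int[OF \<eta>] by auto
    ultimately show "(LINT x|M. (u x - c) * of_real (\<eta> x)) = 0"
      unfolding left_diff_distrib using * L1_loc_test_integrable[OF u \<eta>]
      by (subst Bochner_Integration.integral_diff) auto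
  qed
  then show ?thesis by auto
qed

text \<open>
  The function and the primitive of its weak derivative have the same weak derivative, so their
  difference is constant.
\<close>

lemma has_weak_deriv_imp_is_primitive:
  assumes f: "has_weak_deriv f g" and g: "integrable M g"
  shows "\<exists>c. is_primitive c g f"
proof -
  have fL: "f \<in> L1_loc" using f by (simp add: has_weak_deriv_def)
  have "is_primitive 0 g (primitive g)"
    using g primitive_measurable by (simp add: is_primitive_def)
  from is_primitive_has_weak_deriv[OF this]
  have p: "has_weak_deriv (primitive g) g" .
  then have pL: "primitive g \<in> L1_loc" by (simp add: has_weak_deriv_def)
  have "\<exists>c. AE x in M. f x - primitive g x = c"
  proof (rule du_Bois_Reymond)
    fix \<eta> assume \<eta>: "\<eta> \<in> test_functions"
    note d = test_function_props(6)[OF \<eta>]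
    show "(LINT x|M. (f x - primitive g x) * of_real (deriv \<eta> x)) = 0"
      using f p \<eta> L1_loc_test_integrable[OF fL d] L1_loc_test_integrable[OF pL d]
      by (auto simp: left_diff_distrib has_weak_deriv_def)
  qed (intro L1_loc_diff fL pL)
  then obtain c where "AE x in M. f x - primitive g x = c" by blast
  then have "AE x in M. f x = c + primitive g x"
    by eventually_elim (auto simp: algebra_simps)
  then show ?thesis
    using fL g by (auto simp: is_primitive_def L1_loc_def)
qed

section \<open>The weight and the trace inequality\<close>

lemma omega_nonneg: "x \<in> {0..pi} \<Longrightarrow> 0 \<le> omega x"
  by (simp add: omega_def sin_ge_zero)

lemma omega_pos: "x \<in> I0pi \<Longrightarrow> 0 < omega x"
  by (simp add: omega_def sin_gt_zero)

lemma continuous_on_omega: "continuous_on A omega"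
  unfolding omega_def by (intro continuous_intros)

lemma omega_measurable [measurable]: "omega \<in> borel_measurable M"
  by (intro measurable_M_continuous continuous_on_omega)

lemma sin_ge_half: "x / 2 \<le> sin x" if "0 \<le> x" "x \<le> 1" for x :: real
proof -
  have "sin 0 - 0/2 \<le> sin x - x/2"
  proof (rule DERIV_nonneg_imp_nondecreasing[OF that(1)])
    fix t assume t: "0 \<le> t" "t \<le> x"
    have "cos (pi/3) \<le> cos t"
      using t that pi_gt3 by (intro cos_monotone_0_pi_le) auto
    then have "0 \<le> cos t - 1/2" by (simp add: cos_60)
    moreover have "((\<lambda>x. sin x - x/2) has_real_derivative cos t - 1/2) (at t)"
      by (auto intro!: derivative_eq_intros)
    ultimately show "\<exists>y. ((\<lambda>x. sin x - x/2) has_real_derivative y) (at t) \<and> 0 \<le> y" by blast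
  qed
  then show ?thesis by simp
qed

text \<open>
  The part of the interval at distance less than \<open>\<delta>\<close> from the endpoint \<open>e\<close>; using \<open>\<bar>x - e\<bar>\<close> treats both
  endpoints alike.
\<close>

definition near :: "real \<Rightarrow> real \<Rightarrow> real set" where
  "near e \<delta> = {x \<in> I0pi. \<bar>x - e\<bar> < \<delta>}"

lemma omega_near_endpoint:
  assumes e: "e \<in> {0, pi}" and x: "x \<in> near e 1"
  shows "inverse (omega x) \<le> 3/2 * inverse (sqrt \<bar>x - e\<bar>)"
proof -
  have pos: "0 < \<bar>x - e\<bar>" "\<bar>x - e\<bar> \<le> 1" using e x by (auto simp: near_def)
  have "sin x = sin \<bar>x - e\<bar>" using e x by (auto simp: near_def)
  then have "\<bar>x - e\<bar> / 2 \<le> sin x" using sin_ge_half[of "\<bar>x - e\<bar>"] pos by simp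
  \<comment> \<open>\<open>1/2\<close> is replaced by the smaller square \<open>4/9\<close> to have a rational root.\<close>
  then have "(2/3)^2 * \<bar>x - e\<bar> \<le> sin x"
  proof -
    have "(2/3)^2 * d \<le> t" if "d / 2 \<le> t" "0 \<le> d" for d t :: real
      using that by (simp add: power2_eq_square)
    then show ?thesis using \<open>\<bar>x - e\<bar> / 2 \<le> sin x\<close> abs_ge_zero by blast
  qed
  then have "sqrt ((2/3)^2 * \<bar>x - e\<bar>) \<le> omega x" unfolding omega_def by (rule real_sqrt_le_mono)
  then have "2/3 * sqrt \<bar>x - e\<bar> \<le> omega x" by (simp add: real_sqrt_mult)
  then have "inverse (omega x) \<le> inverse (2/3 * sqrt \<bar>x - e\<bar>)"
    using pos by (intro le_imp_inverse_le) auto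
  then show ?thesis by (simp add: field_simps)
qed

lemma near_sets: "near e \<delta> \<in> sets lebesgue" "near e \<delta> \<in> sets M"
proof -
  have eq: "near e \<delta> = {max 0 (e - \<delta>)<..<min pi (e + \<delta>)}" by (auto simp: near_def)
  show "near e \<delta> \<in> sets lebesgue" unfolding eq by simp
  show "near e \<delta> \<in> sets M"
    unfolding sets_restrict_space by (rule image_eqI[of _ _ "near e \<delta>"]) (auto simp: eq)
qed

lemma near_eq:
  assumes "e \<in> {0, pi}" "0 < \<delta>" "\<delta> \<le> 1"
  shows "near e \<delta> = (if e = 0 then {0<..<\<delta>} else {pi - \<delta><..<pi})"
  using assms pi_gt3 by (auto simp: near_def)

lemma integral_inverse_sqrt_near:
  assumes e: "e \<in> {0, pi}" and \<delta>: "0 < \<delta>" "\<delta> \<le> 1"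
  shows "integrable M (\<lambda>x. indicator (near e \<delta>) x * inverse (sqrt \<bar>x - e\<bar>))"
    and "(LINT x|M. indicator (near e \<delta>) x * inverse (sqrt \<bar>x - e\<bar>)) = 2 * sqrt \<delta>"
proof -
  have HI: "((\<lambda>x. inverse (sqrt \<bar>x - e\<bar>)) has_integral 2 * sqrt \<delta>) (near e \<delta>)"
  proof (cases "e = 0")
    case True
    have "((\<lambda>x. inverse (sqrt \<bar>x - e\<bar>)) has_integral (2 * sqrt \<delta> - 2 * sqrt 0)) {0..\<delta>}"
    proof (rule fundamental_theorem_of_calculus_interior)
      fix x assume "x \<in> {0<..<\<delta>}"
      then have "((\<lambda>x. 2 * sqrt x) has_real_derivative inverse (sqrt \<bar>x - e\<bar>)) (at x)"
        using True by (auto intro!: derivative_eq_intros simp: field_simps)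
      then show "((\<lambda>x. 2 * sqrt x) has_vector_derivative inverse (sqrt \<bar>x - e\<bar>)) (at x)"
        by (simp add: has_real_derivative_iff_has_vector_derivative)
    qed (use \<delta> in \<open>auto intro!: continuous_intros\<close>)
    then show ?thesis
      using near_eq[OF assms] True by (simp add: has_integral_Icc_iff_Ioo)
  next
    case False
    then have e: "e = pi" using e by auto
    have "((\<lambda>x. inverse (sqrt \<bar>x - e\<bar>)) has_integral
        ((- 2 * sqrt (pi - pi)) - (- 2 * sqrt (pi - (pi - \<delta>))))) {pi - \<delta>..pi}"
    proof (rule fundamental_theorem_of_calculus_interior)
      fix x assume "x \<in> {pi - \<delta><..<pi}"
      then have "((\<lambda>x. - 2 * sqrt (pi - x)) has_real_derivative inverse (sqrt \<bar>x - e\<bar>)) (at x)"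
        using e by (auto intro!: derivative_eq_intros simp: field_simps)
      then show "((\<lambda>x. - 2 * sqrt (pi - x)) has_vector_derivative inverse (sqrt \<bar>x - e\<bar>)) (at x)"
        by (simp add: has_real_derivative_iff_has_vector_derivative)
    qed (use \<delta> in \<open>auto intro!: continuous_intros\<close>)
    then show ?thesis
      using near_eq[OF assms] e by (simp add: has_integral_Icc_iff_Ioo)
  qed
  then have "(\<lambda>x. inverse (sqrt \<bar>x - e\<bar>)) absolutely_integrable_on near e \<delta>"
    by (intro nonnegative_absolutely_integrable_1) (auto simp: integrable_on_def)
  then have int: "integrable (lebesgue_on (near e \<delta>)) (\<lambda>x. inverse (sqrt \<bar>x - e\<bar>))"
    using near_sets by (simp add: set_integrable_def integrable_restrict_space)
  have sub: "near e \<delta> \<subseteq> I0pi" by (auto simp: near_def)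
  show "integrable M (\<lambda>x. indicator (near e \<delta>) x * inverse (sqrt \<bar>x - e\<bar>))"
    using integral_M_indicator(2)[OF sub near_sets(1), of "\<lambda>x. inverse (sqrt \<bar>x - e\<bar>)"] int by simp
  show "(LINT x|M. indicator (near e \<delta>) x * inverse (sqrt \<bar>x - e\<bar>)) = 2 * sqrt \<delta>"
    using integral_M_indicator(1)[OF sub near_sets(1), of "\<lambda>x. inverse (sqrt \<bar>x - e\<bar>)"]
      lebesgue_integral_eq_integral[OF int near_sets(1)] integral_unique[OF HI] by simp
qed

text \<open>
  The source of the exponent in the trace inequality: the weight degenerates like a square root, so
  the integral of its inverse over distance \<open>\<delta>\<close> is of order \<open>sqrt \<delta>\<close>.
\<close>

lemma integral_inverse_omega_near:
  assumes e: "e \<in> {0, pi}" and \<delta>: "0 < \<delta>" "\<delta> \<le> 1"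
  shows "integrable M (\<lambda>x. indicator (near e \<delta>) x * inverse (omega x))"
    and "(LINT x|M. indicator (near e \<delta>) x * inverse (omega x)) \<le> 3 * sqrt \<delta>"
proof -
  note [measurable] = near_sets(2)[of e \<delta>]
  have bound: "indicator (near e \<delta>) x * inverse (omega x)
      \<le> 3/2 * (indicator (near e \<delta>) x * inverse (sqrt \<bar>x - e\<bar>))" for x
    using omega_near_endpoint[OF e, of x] \<delta> by (auto simp: indicator_def near_def)
  have nonneg: "0 \<le> indicator (near e \<delta>) x * inverse (omega x)" if "x \<in> space M" for x
    using that omega_pos[of x] by (auto simp: indicator_def)
  have int: "integrable M (\<lambda>x. 3/2 * (indicator (near e \<delta>) x * inverse (sqrt \<bar>x - e\<bar>)))"
    by (intro integrable_mult_right integral_inverse_sqrt_near assms)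
  show 1: "integrable M (\<lambda>x. indicator (near e \<delta>) x * inverse (omega x))"
  proof (rule Bochner_Integration.integrable_bound[OF int])
    show "AE x in M. norm (indicator (near e \<delta>) x * inverse (omega x))
        \<le> norm (3/2 * (indicator (near e \<delta>) x * inverse (sqrt \<bar>x - e\<bar>)))"
    proof (rule AE_I2)
      fix x assume "x \<in> space M"
      from nonneg[OF this] bound[of x] 
      show "norm (indicator (near e \<delta>) x * inverse (omega x))
        \<le> norm (3/2 * (indicator (near e \<delta>) x * inverse (sqrt \<bar>x - e\<bar>)))"
        unfolding real_norm_def by linarith
    qed
  qed measurable
  have "(LINT x|M. indicator (near e \<delta>) x * inverse (omega x))
      \<le> (LINT x|M. 3/2 * (indicator (near e \<delta>) x * inverse (sqrt \<bar>x - e\<bar>)))"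
    by (rule integral_mono[OF 1 int bound])
  also have "\<dots> = 3/2 * (2 * sqrt \<delta>)"
    by (simp only: integral_mult_right_zero integral_inverse_sqrt_near[OF assms])
  finally show "(LINT x|M. indicator (near e \<delta>) x * inverse (omega x)) \<le> 3 * sqrt \<delta>" by simp
qed

lemma integrable_inverse_omega: "integrable M (\<lambda>x. inverse (omega x))"
proof (rule Bochner_Integration.integrable_bound)
  let ?b = "\<lambda>x. indicator (near 0 1) x * inverse (omega x) + indicator (near pi 1) x * inverse (omega x) + 2"
  show "integrable M ?b"
    by (intro Bochner_Integration.integrable_add integral_inverse_omega_near) auto
  show "AE x in M. norm (inverse (omega x)) \<le> norm (?b x)"
  proof (rule AE_I2)
    fix x assume "x \<in> space M"
    then have x: "x \<in> I0pi" by simp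
    have "inverse (omega x) \<le> ?b x"
    proof (cases "x \<in> near 0 1 \<union> near pi 1")
      case True
      then show ?thesis using omega_pos[OF x] by (auto simp: indicator_def)
    next
      case False
      then have x1: "1 \<le> x" "x \<le> pi - 1" using x by (auto simp: near_def)
      have "1/2 \<le> sin x"
      proof (cases "x \<le> pi/2")
        case True
        have "1/2 \<le> sin (1::real)" using sin_ge_half[of 1] by simp
        also have "\<dots> \<le> sin x" using x1 True by (intro sin_monotone_2pi_le) auto
        finally show ?thesis .
      next
        case False
        have "1/2 \<le> sin (1::real)" using sin_ge_half[of 1] by simp
        also have "\<dots> \<le> sin (pi - x)" using x1 False by (intro sin_monotone_2pi_le) auto
        finally show ?thesis by simp
      qed
      then have "sqrt ((1/2)^2) \<le> omega x"
        unfolding omega_def by (intro real_sqrt_le_mono) (simp add: power2_eq_square)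
      then have "1/2 \<le> omega x" by simp
      then have "inverse (omega x) \<le> 2" by (simp add: field_simps)
      then show ?thesis using False by auto
    qed
    then show "norm (inverse (omega x)) \<le> norm (?b x)" using omega_pos[OF x] by simp
  qed
qed measurable

text \<open>
  The discriminant argument behind the Cauchy-Schwarz inequality.
\<close>

lemma square_le_mult_if_quadratic:
  fixes X K Y :: real
  assumes "0 \<le> X" "0 \<le> K" "0 \<le> Y" and le: "\<And>t. t > 0 \<Longrightarrow> 2 * X \<le> t * K + Y / t"
  shows "X\<^sup>2 \<le> K * Y"
proof (cases "X = 0")
  case False
  then have X: "X > 0" using assms by simp
  show ?thesis
  proof (cases "K = 0")
    case True
    \<comment> \<open>For \<open>K = 0\<close> the bound fails for large \<open>t\<close> unless \<open>X = 0\<close>.\<close>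
    have "Y / ((Y + 1) / X) = X * (Y / (Y + 1))" by simp
    also have "\<dots> < X * 2"
      using X assms by (intro mult_strict_left_mono) (auto simp: field_simps)
    finally show ?thesis using le[of "(Y + 1) / X"] X assms True by (auto simp: mult.commute)
  next
    case False
    \<comment> \<open>The minimum of \<open>t\<^sup>2 K - 2 t X + Y\<close>.\<close>
    then show ?thesis using le[of "X / K"] X assms by (auto simp: field_simps power2_eq_square)
  qed
qed (use assms in simp)

text \<open>
  The square of \<open>H_norm\<close>, which spares the root; it is applied to functions and to their derivatives.
\<close>

definition H_sq :: "(real \<Rightarrow> complex) \<Rightarrow> real" where
  "H_sq u = (LINT x|M. omega x * (cmod (u x))\<^sup>2)"

lemma H_sq_nonneg: "0 \<le> H_sq u"
  unfolding H_sq_def by (rule Bochner_Integration.integral_nonneg) (auto simp: omega_nonneg)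

lemma H_norm_power2: "(H_norm u)\<^sup>2 = H_sq u"
  using H_sq_nonneg[of u] by (simp add: H_norm_def H_sq_def)

text \<open>
  Cauchy-Schwarz for the factorisation \<open>|u| = (1 / sqrt omega) (sqrt omega |u|)\<close>; integrability of the
  left-hand side comes from Young's inequality for the same factors.
\<close>

lemma weighted_Cauchy_Schwarz:
  assumes u: "u \<in> H_space" and A: "A \<in> sets M"
    and int: "integrable M (\<lambda>x. indicator A x * inverse (omega x))"
  shows "integrable M (\<lambda>x. indicator A x * cmod (u x))"
    and "(LINT x|M. indicator A x * cmod (u x))\<^sup>2
           \<le> (LINT x|M. indicator A x * inverse (omega x)) * H_sq u"
proof -
  have um[measurable]: "u \<in> borel_measurable M" and ui: "integrable M (\<lambda>x. omega x * (cmod (u x))\<^sup>2)"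
    using u by (auto simp: H_space_def)
  have young: "2 * (indicator A x * cmod (u x))
      \<le> t * (indicator A x * inverse (omega x)) + omega x * (cmod (u x))\<^sup>2 / t"
    if x: "x \<in> space M" and t: "t > 0" for x t
  proof (cases "x \<in> A")
    case True
    have om: "omega x > 0" using x omega_pos by simp
    have "0 \<le> (t - omega x * cmod (u x))\<^sup>2 / (t * omega x)" using t om by simp
    also have "\<dots> = t * inverse (omega x) + omega x * (cmod (u x))\<^sup>2 / t - 2 * cmod (u x)"
      using t om by (simp add: field_simps power2_eq_square)
    finally show ?thesis using True by simp
  qed (use x t omega_pos[of x] in simp)
  have rhs: "integrable M (\<lambda>x. t * (indicator A x * inverse (omega x)) + omega x * (cmod (u x))\<^sup>2 / t)" for t
    using int ui by simp
  show 1: "integrable M (\<lambda>x. indicator A x * cmod (u x))"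
  proof (rule Bochner_Integration.integrable_bound[OF rhs[of 1]])
    show "AE x in M. norm (indicator A x * cmod (u x))
        \<le> norm (1 * (indicator A x * inverse (omega x)) + omega x * (cmod (u x))\<^sup>2 / 1)"
    proof (rule AE_I2)
      fix x assume "x \<in> space M"
      moreover have "0 \<le> indicator A x * cmod (u x)" by simp
      ultimately show "norm (indicator A x * cmod (u x))
        \<le> norm (1 * (indicator A x * inverse (omega x)) + omega x * (cmod (u x))\<^sup>2 / 1)"
        using young[of x 1] unfolding real_norm_def by linarith
    qed
  qed (use A in measurable)
  show "(LINT x|M. indicator A x * cmod (u x))\<^sup>2
           \<le> (LINT x|M. indicator A x * inverse (omega x)) * H_sq u"
  proof (rule square_le_mult_if_quadratic)
    show "0 \<le> (LINT x|M. indicator A x * cmod (u x))" by (rule Bochner_Integration.integral_nonneg) simp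
    show "0 \<le> (LINT x|M. indicator A x * inverse (omega x))"
      by (rule Bochner_Integration.integral_nonneg) (auto simp: omega_nonneg)
    fix t :: real assume t: "t > 0"
    have "2 * (LINT x|M. indicator A x * cmod (u x)) = (LINT x|M. 2 * (indicator A x * cmod (u x)))"
      by simp
    also have "\<dots> \<le> (LINT x|M. t * (indicator A x * inverse (omega x)) + omega x * (cmod (u x))\<^sup>2 / t)"
      using young t by (intro integral_mono rhs integrable_mult_right 1) auto
    also have "\<dots> = t * (LINT x|M. indicator A x * inverse (omega x)) + H_sq u / t"
      using int ui by (simp add: H_sq_def)
    finally show "2 * (LINT x|M. indicator A x * cmod (u x))
      \<le> t * (LINT x|M. indicator A x * inverse (omega x)) + H_sq u / t" .
  qed (rule H_sq_nonneg)
qed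

lemma H_space_imp_integrable:
  assumes "u \<in> H_space" shows "integrable M u"
proof -
  have [measurable]: "u \<in> borel_measurable M" using assms by (auto simp: H_space_def)
  have "integrable M (\<lambda>x. indicator I0pi x * cmod (u x))"
    by (rule weighted_Cauchy_Schwarz[OF assms])
       (auto intro!: Bochner_Integration.integrable_bound[OF integrable_inverse_omega] simp: indicator_def)
  then have "integrable M (\<lambda>x. cmod (u x))"
    by (rule Bochner_Integration.integrable_cong[OF refl, THEN iffD1, rotated]) simp
  then show ?thesis by (simp add: integrable_norm_iff)
qed

text \<open>
  Finite energy makes the weak derivative integrable up to the endpoints, not just locally.
\<close>

lemma V_space_is_primitive:
  assumes "f \<in> V_space"
  shows "weak_deriv f \<in> H_space" "\<exists>c. is_primitive c (weak_deriv f) f"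
proof -
  obtain g where "has_weak_deriv f g" using assms by (auto simp: V_space_def H1_loc_def)
  then have wd: "has_weak_deriv f (weak_deriv f)" unfolding weak_deriv_def by (rule someI[of "has_weak_deriv f"])
  then show H: "weak_deriv f \<in> H_space"
    using assms by (auto simp: V_space_def H_space_def has_weak_deriv_def L1_loc_def)
  show "\<exists>c. is_primitive c (weak_deriv f) f"
    using has_weak_deriv_imp_is_primitive[OF wd H_space_imp_integrable[OF H]] .
qed

text \<open>
  The set where two continuous functions differ is open, and nonempty open sets are not null.
\<close>

lemma continuous_eq_if_AE_eq:
  fixes g h :: "real \<Rightarrow> complex"
  assumes "continuous_on I0pi g" "continuous_on I0pi h" "AE x in M. g x = h x" "y \<in> I0pi"
  shows "g y = h y"
proof (rule ccontr)
  assume ne: "g y \<noteq> h y"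
  define U where "U = {x \<in> I0pi. g x - h x \<in> - {0}}"
  have "open U"
    using continuous_open_preimage[of I0pi "\<lambda>x. g x - h x" "- {0}"] assms(1,2)
    unfolding U_def vimage_def Int_def by (auto intro: continuous_on_diff)
  moreover have "AE x in lebesgue. x \<in> U \<longrightarrow> x \<in> {}"
    using assms(3) unfolding AE_M_iff by (rule AE_mp) (auto simp: U_def)
  moreover have "y \<in> U" using ne assms by (auto simp: U_def)
  ultimately have "y \<in> {}" by (intro mem_closed_if_AE_lebesgue_open[of U "{}"]) auto
  then show False by simp
qed

text \<open>
  The primitive is one admissible continuous representative; uniqueness of continuous
  representatives shows that it is the only one.
\<close>

lemma endpoint_value_eq:
  assumes f: "is_primitive c g f" and e: "e \<in> {0, pi}"
  shows "endpoint_value f e = c + primitive g e"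
proof -
  have g: "integrable M g" and eq: "AE x in M. f x = c + primitive g x"
    using f by (auto simp: is_primitive_def)
  have cont: "continuous_on {0..pi} (\<lambda>x. c + primitive g x)"
    by (intro continuous_intros continuous_on_primitive g)
  have sub: "I0pi \<subseteq> {0..pi}" by auto
  note cont' = continuous_on_subset[OF cont sub]
  have lim: "((\<lambda>x. c + primitive g x) \<longlongrightarrow> c + primitive g e) (at e within I0pi)"
  proof -
    have "e \<in> {0..pi}" using e by auto
    then have "((\<lambda>x. c + primitive g x) \<longlongrightarrow> c + primitive g e) (at e within {0..pi})"
      using cont by (simp add: continuous_on_def)
    then show ?thesis by (rule tendsto_within_subset[OF _ sub])
  qed
  have nontriv: "at e within I0pi \<noteq> bot"
  proof -
    have "e \<in> closure I0pi" using e pi_gt_zero by (auto simp del: pi_gt_zero)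
    then show ?thesis using e by (auto simp: trivial_limit_within islimpt_in_closure)
  qed
  show ?thesis
    unfolding endpoint_value_def
  proof (rule the_equality)
    show "\<exists>h. continuous_on I0pi h \<and> (AE x in M. h x = f x) \<and> (h \<longlongrightarrow> c + primitive g e) (at e within I0pi)"
    proof (intro exI conjI)
      show "AE x in M. c + primitive g x = f x" using eq by eventually_elim simp
    qed (fact cont' lim)+
    fix c' assume "\<exists>h. continuous_on I0pi h \<and> (AE x in M. h x = f x) \<and> (h \<longlongrightarrow> c') (at e within I0pi)"
    then obtain h where h: "continuous_on I0pi h" "AE x in M. h x = f x" "(h \<longlongrightarrow> c') (at e within I0pi)"
      by blast
    from h(2) eq have "AE x in M. h x = c + primitive g x" by eventually_elim simp
    then have "h y = c + primitive g y" if "y \<in> I0pi" for y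
      using continuous_eq_if_AE_eq[OF h(1) cont'] that by blast
    then have "((\<lambda>x. c + primitive g x) \<longlongrightarrow> c') (at e within I0pi)"
      by (intro Lim_transform_eventually[OF h(3)]) (auto simp: eventually_at_filter)
    then show "c' = c + primitive g e"
      using tendsto_unique[OF nontriv _ lim] by blast
  qed
qed

text \<open>
  The square removes the kink of the positive part, so the cutoff below is continuously
  differentiable.
\<close>

lemma DERIV_pos_part_square [derivative_intros]:
  fixes y :: "real \<Rightarrow> real"
  assumes "(y has_real_derivative y') (at x)"
  shows "((\<lambda>x. (max 0 (y x))\<^sup>2) has_real_derivative 2 * max 0 (y x) * y') (at x)"
proof -
  have "((\<lambda>z::real. (max 0 z)\<^sup>2) has_real_derivative 2 * max 0 z) (at z)" for z
  proof -
    consider "z < 0" | "z = 0" | "z > 0" by linarith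
    then show ?thesis
    proof cases
      case 1
      have "\<forall>\<^sub>F t in nhds z. (max 0 t)\<^sup>2 = (\<lambda>_. 0) t"
        using eventually_nhds_in_open[of "{..<0}" z] 1 by (auto elim!: eventually_mono)
      then show ?thesis using 1 DERIV_cong_ev[of z z "\<lambda>z. (max 0 z)\<^sup>2" "\<lambda>_. 0" 0 0] by simp
    next
      case 2
      have "((\<lambda>h::real. max 0 h) \<longlongrightarrow> max 0 0) (at 0)" by (intro tendsto_intros)
      moreover have "\<forall>\<^sub>F h in at 0. max 0 h = (max 0 h)\<^sup>2 / (h::real)"
        by (auto simp: eventually_at_filter max_def power2_eq_square)
      ultimately have "((\<lambda>h::real. (max 0 h)\<^sup>2 / h) \<longlongrightarrow> 0) (at 0)"
        by (simp add: tendsto_cong)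
      then show ?thesis using 2 by (simp add: has_field_derivative_iff)
    next
      case 3
      have "\<forall>\<^sub>F t in nhds z. (max 0 t)\<^sup>2 = t\<^sup>2"
        using eventually_nhds_in_open[of "{0<..}" z] 3 by (auto elim!: eventually_mono)
      moreover have "((\<lambda>t. t\<^sup>2) has_real_derivative 2 * z) (at z)"
        by (auto intro!: derivative_eq_intros)
      ultimately show ?thesis
        using 3 DERIV_cong_ev[of z z "\<lambda>z. (max 0 z)\<^sup>2" "\<lambda>t. t\<^sup>2" "2 * z" "2 * z"] by simp
    qed
  qed
  from DERIV_chain2[OF this assms] show ?thesis by simp
qed

lemma cutoff_integral_bound:
  assumes u: "u \<in> H_space" and e: "e \<in> {0, pi}" and \<delta>: "0 < \<delta>" "\<delta> \<le> 1"
    and v: "v \<in> borel_measurable M"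
    and bound: "\<And>x. x \<in> I0pi \<Longrightarrow> \<bar>v x\<bar> \<le> B * indicator (near e \<delta>) x" and B: "0 \<le> B"
  shows "(cmod (LINT x|M. u x * of_real (v x)))\<^sup>2 \<le> B\<^sup>2 * (3 * sqrt \<delta> * H_sq u)"
proof -
  note CS = weighted_Cauchy_Schwarz[OF u near_sets(2) integral_inverse_omega_near(1)[OF e \<delta>]]
  let ?X = "LINT x|M. indicator (near e \<delta>) x * cmod (u x)"
  note [measurable] = v
  have [measurable]: "u \<in> borel_measurable M" using u by (simp add: H_space_def)
  have "cmod (LINT x|M. u x * of_real (v x)) \<le> (LINT x|M. B * (indicator (near e \<delta>) x * cmod (u x)))"
  proof (rule Bochner_Integration.integral_norm_bound_integral)
    show int: "integrable M (\<lambda>x. B * (indicator (near e \<delta>) x * cmod (u x)))"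
      by (intro integrable_mult_right CS)
    show b: "norm (u x * of_real (v x)) \<le> B * (indicator (near e \<delta>) x * cmod (u x))" if "x \<in> space M" for x
      using mult_left_mono[OF bound[of x], of "cmod (u x)"] that by (simp add: norm_mult mult_ac)
    show "integrable M (\<lambda>x. u x * of_real (v x))"
    proof (rule Bochner_Integration.integrable_bound[OF int])
      show "AE x in M. norm (u x * of_real (v x)) \<le> norm (B * (indicator (near e \<delta>) x * cmod (u x)))"
        unfolding real_norm_def by (intro AE_I2 order_trans[OF b abs_ge_self])
    qed measurable
  qed
  then have "cmod (LINT x|M. u x * of_real (v x)) \<le> B * ?X" by simp
  then have "(cmod (LINT x|M. u x * of_real (v x)))\<^sup>2 \<le> B\<^sup>2 * ?X\<^sup>2"
    using power_mono[of "cmod (LINT x|M. u x * of_real (v x))" "B * ?X" 2] by (simp add: power_mult_distrib)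
  also have "?X\<^sup>2 \<le> 3 * sqrt \<delta> * H_sq u"
    using CS(2) mult_right_mono[OF integral_inverse_omega_near(2)[OF e \<delta>] H_sq_nonneg[of u]] by linarith
  finally show ?thesis by (simp add: mult_left_mono)
qed

text \<open>
  Integration by parts against a cutoff that is \<open>1\<close> at the endpoint \<open>e\<close> and vanishes at distance
  \<open>\<delta>\<close> expresses the endpoint value through integrals of \<open>f w'\<close> and \<open>g w\<close> near \<open>e\<close>, where \<open>w\<close> is at
  most \<open>1\<close> and its derivative at most \<open>2/\<delta>\<close>.
\<close>

lemma trace_inequality:
  assumes f: "is_primitive c g f" and fH: "f \<in> H_space" and gH: "g \<in> H_space"
    and e: "e \<in> {0, pi}" and \<delta>: "0 < \<delta>" "\<delta> \<le> 1"
  shows "(cmod (endpoint_value f e))\<^sup>2 \<le> 24 * (sqrt \<delta> * H_sq g + sqrt \<delta> / \<delta>\<^sup>2 * H_sq f)"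
proof -
  \<comment> \<open>With the sign \<open>s\<close>, the distance to the endpoint \<open>e\<close> is the smooth expression \<open>s * (x - e)\<close>.\<close>
  define s :: real where "s = (if e = 0 then 1 else - 1)"
  define y where "y = (\<lambda>x. 1 - s * (x - e) / \<delta>)"
  define w where "w = (\<lambda>x. (max 0 (y x))\<^sup>2)"
  define w' where "w' = (\<lambda>x. 2 * max 0 (y x) * (- s / \<delta>))"
  have abs: "\<bar>x - e\<bar> = s * (x - e)" if "x \<in> {0..pi}" for x
    using that e by (auto simp: s_def)
  have y: "max 0 (y x) \<le> indicator (near e \<delta>) x" if "x \<in> I0pi" for x
    using that abs[of x] \<delta> by (auto simp: y_def near_def indicator_def field_simps)
  have s1: "\<bar>s\<bar> = 1" by (simp add: s_def)
  have cont: "continuous_on {0..pi} w" "continuous_on {0..pi} w'"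
    unfolding w_def w'_def y_def using \<delta> by (auto intro!: continuous_intros)
  have deriv: "(w has_real_derivative w' x) (at x)" for x
    unfolding w_def w'_def y_def using \<delta> by (auto intro!: derivative_eq_intros)
  have meas: "w \<in> borel_measurable M" "w' \<in> borel_measurable M"
    using cont by (auto intro!: measurable_M_continuous elim: continuous_on_subset)
  have wb: "\<bar>w x\<bar> \<le> 1 * indicator (near e \<delta>) x" if "x \<in> I0pi" for x
    using power_mono[OF y[OF that], of 2] by (cases "x \<in> near e \<delta>") (auto simp: w_def)
  have w'b: "\<bar>w' x\<bar> \<le> 2/\<delta> * indicator (near e \<delta>) x" if "x \<in> I0pi" for x
    using mult_left_mono[OF y[OF that], of "2/\<delta>"] \<delta> s1 by (auto simp: w'_def abs_mult)
  have parts: "(LINT x|M. f x * of_real (w' x))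
      = (c + primitive g pi) * of_real (w pi) - c * of_real (w 0) - (LINT x|M. g x * of_real (w x))"
    by (rule is_primitive_by_parts[OF f cont(1) _ cont(2)]) (rule deriv)
  have vals: "w e = 1" "w (pi - e) = 0"
    using e \<delta> pi_gt3 by (auto simp: w_def y_def s_def field_simps max_def)
  have ep: "endpoint_value f e = c + primitive g e" by (rule endpoint_value_eq[OF f e])
  define A B where "A = (LINT x|M. f x * of_real (w' x))" and "B = (LINT x|M. g x * of_real (w x))"
  have "A + B = (if e = 0 then - c else c + primitive g pi)"
    using parts vals e unfolding A_def[symmetric] B_def[symmetric] by auto
  then have "cmod (endpoint_value f e) = cmod (A + B)"
    using e unfolding ep by auto
  also have "\<dots> \<le> cmod A + cmod B" by (rule norm_triangle_ineq)
  finally have "(cmod (endpoint_value f e))\<^sup>2 \<le> (cmod A + cmod B)\<^sup>2" by (rule power_mono) simp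
  also have "\<dots> \<le> 2 * (cmod A)\<^sup>2 + 2 * (cmod B)\<^sup>2"
    using zero_le_power2[of "cmod A - cmod B"] by (simp add: power2_sum power2_diff)
  also have "(cmod A)\<^sup>2 \<le> (2/\<delta>)\<^sup>2 * (3 * sqrt \<delta> * H_sq f)"
    unfolding A_def using \<delta> by (intro cutoff_integral_bound[OF fH e \<delta> meas(2) w'b]) auto
  also have "(cmod B)\<^sup>2 \<le> 1\<^sup>2 * (3 * sqrt \<delta> * H_sq g)"
    unfolding B_def by (intro cutoff_integral_bound[OF gH e \<delta> meas(1) wb]) auto
  also have "2 * ((2/\<delta>)\<^sup>2 * (3 * sqrt \<delta> * H_sq f)) + 2 * (1\<^sup>2 * (3 * sqrt \<delta> * H_sq g))
      \<le> 24 * (sqrt \<delta> * H_sq g + sqrt \<delta> / \<delta>\<^sup>2 * H_sq f)"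
    using H_sq_nonneg[of g] \<delta> by (simp add: power_divide field_simps)
  finally show ?thesis by simp
qed

section \<open>Gegenbauer polynomials as weak eigenfunctions\<close>

lemma real_polynomial_gegenbauer: "real_polynomial_function (gegenbauer l n)"
proof (induction n rule: less_induct)
  case (less n)
  consider "n = 0" | "n = Suc 0" | m where "n = Suc (Suc m)"
    by (metis nat.exhaust)
  then show ?case
  proof cases
    case (3 m)
    have "real_polynomial_function (\<lambda>x. inverse (real m + 2) *
        ((2 * (real m + 1 + l)) * (x * gegenbauer l (Suc m) x) + (- (real m + 2 * l)) * gegenbauer l m x))"
      by (intro real_polynomial_function.intros(2-4) less.IH
            real_polynomial_function.intros(1)[OF bounded_linear_ident]) (auto simp: 3)
    then show ?thesis
      by (rule back_subst[of real_polynomial_function]) (auto simp: 3 field_simps)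
  qed (auto simp: gegenbauer.simps[abs_def] intro!: real_polynomial_function.intros bounded_linear_mult_right)
qed

lemma real_polynomial_has_deriv:
  assumes "real_polynomial_function p"
  shows "(p has_real_derivative deriv p x) (at x)" "real_polynomial_function (deriv p)"
proof -
  obtain p' where p': "real_polynomial_function p'" "\<And>x. (p has_real_derivative p' x) (at x)"
    using has_real_derivative_polynomial_function[OF assms] by blast
  then have "deriv p = p'" by (auto intro!: DERIV_imp_deriv)
  with p' show "(p has_real_derivative deriv p x) (at x)" "real_polynomial_function (deriv p)" by auto
qed

abbreviation gegenbauer' :: "real \<Rightarrow> nat \<Rightarrow> real \<Rightarrow> real" where
  "gegenbauer' l n \<equiv> deriv (gegenbauer l n)"

lemmas DERIV_gegenbauer = real_polynomial_has_deriv(1)[OF real_polynomial_gegenbauer]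
lemmas DERIV_gegenbauer' =
  real_polynomial_has_deriv(1)[OF real_polynomial_has_deriv(2)[OF real_polynomial_gegenbauer]]

lemma gegenbauer'_rec:
  "(real n + 2) * gegenbauer' l (Suc (Suc n)) x
     = 2 * (real n + 1 + l) * (gegenbauer l (Suc n) x + x * gegenbauer' l (Suc n) x)
       - (real n + 2 * l) * gegenbauer' l n x"
proof -
  have "((\<lambda>x. gegenbauer l (Suc (Suc n)) x) has_real_derivative
      (2 * (real n + 1 + l) * (gegenbauer l (Suc n) x + x * gegenbauer' l (Suc n) x)
       - (real n + 2 * l) * gegenbauer' l n x) / (real n + 2)) (at x)"
    unfolding gegenbauer.simps(3)
    by (auto simp del: gegenbauer.simps intro!: derivative_eq_intros DERIV_gegenbauer)
       (simp add: algebra_simps)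
  from DERIV_imp_deriv[OF this] show ?thesis
    by (simp add: field_simps del: gegenbauer.simps)
qed

text \<open>
  The two classical first-order relations have to be carried through the induction together: each
  step of one uses the other, besides the recurrence and its derivative.
\<close>

lemma gegenbauer'_identities:
  "(1 - x\<^sup>2) * gegenbauer' l (Suc n) x
     = - (real n + 1) * x * gegenbauer l (Suc n) x + (real n + 2 * l) * gegenbauer l n x \<and>
   x * gegenbauer' l (Suc n) x - gegenbauer' l n x = (real n + 1) * gegenbauer l (Suc n) x"
proof (induction n)
  case 0
  have "gegenbauer' l 0 x = 0" "gegenbauer' l (Suc 0) x = 2 * l"
    by (auto intro!: DERIV_imp_deriv derivative_eq_intros simp: gegenbauer.simps[abs_def])
  then show ?case by (simp add: algebra_simps power2_eq_square)
next
  case (Suc n)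
  define m C0 C1 C2 D0 D1 D2 where defs: "m = real n"
    "C0 = gegenbauer l n x" "C1 = gegenbauer l (Suc n) x" "C2 = gegenbauer l (Suc (Suc n)) x"
    "D0 = gegenbauer' l n x" "D1 = gegenbauer' l (Suc n) x" "D2 = gegenbauer' l (Suc (Suc n)) x"
  have h1: "(m + 2) * C2 = 2 * (m + 1 + l) * x * C1 - (m + 2 * l) * C0"
    by (simp add: defs)
  have h2: "(m + 2) * D2 = 2 * (m + 1 + l) * (C1 + x * D1) - (m + 2 * l) * D0"
    unfolding defs by (rule gegenbauer'_rec)
  have hA: "(1 - x\<^sup>2) * D1 = - (m + 1) * x * C1 + (m + 2 * l) * C0"
    and hB: "x * D1 - D0 = (m + 1) * C1"
    using Suc by (simp_all add: defs)
  have B: "(m + 2) * (x * D2 - D1) = (m + 2) * ((m + 2) * C2)"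
    using h1 h2 hA hB by algebra
  have "m + 2 \<noteq> 0" by (simp add: defs)
  with B have B': "x * D2 - D1 = (m + 2) * C2" by simp
  have "(m + 2) * ((1 - x\<^sup>2) * D2) = (m + 2) * (- (m + 2) * x * C2 + (m + 1 + 2 * l) * C1)"
    using h1 h2 hA hB by algebra
  with \<open>m + 2 \<noteq> 0\<close> have "(1 - x\<^sup>2) * D2 = - (m + 2) * x * C2 + (m + 1 + 2 * l) * C1" by simp
  with B' show ?case by (simp add: defs algebra_simps del: gegenbauer.simps)
qed

text \<open>
  Differentiate the first of the two relations and eliminate the derivative of the lower polynomial
  with the second.
\<close>

lemma gegenbauer_ODE:
  "(1 - x\<^sup>2) * deriv (gegenbauer' l n) x - (2 * l + 1) * x * gegenbauer' l n x
     + real n * (real n + 2 * l) * gegenbauer l n x = 0"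
proof (cases n)
  case 0
  have "gegenbauer' l 0 = (\<lambda>x. 0)"
    by (auto intro!: DERIV_imp_deriv derivative_eq_intros simp: gegenbauer.simps[abs_def])
  then show ?thesis using 0 by simp
next
  case (Suc m)
  define C0 C1 D0 D1 DD where defs: "C0 = gegenbauer l m x" "C1 = gegenbauer l (Suc m) x"
    "D0 = gegenbauer' l m x" "D1 = gegenbauer' l (Suc m) x" "DD = deriv (gegenbauer' l (Suc m)) x"
  have "((\<lambda>x. (1 - x\<^sup>2) * gegenbauer' l (Suc m) x) has_real_derivative
      (1 - x\<^sup>2) * DD - 2 * x * D1) (at x)"
    unfolding defs by (auto intro!: derivative_eq_intros DERIV_gegenbauer')
  moreover have "((\<lambda>x. - (real m + 1) * x * gegenbauer l (Suc m) x + (real m + 2 * l) * gegenbauer l m x)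
      has_real_derivative (- (real m + 1) * C1 - (real m + 1) * x * D1 + (real m + 2 * l) * D0)) (at x)"
    unfolding defs
    by (auto simp del: gegenbauer.simps intro!: derivative_eq_intros DERIV_gegenbauer simp: algebra_simps)
  ultimately have h: "(1 - x\<^sup>2) * DD - 2 * x * D1
      = - (real m + 1) * C1 - (real m + 1) * x * D1 + (real m + 2 * l) * D0"
    using gegenbauer'_identities[of _ l m] DERIV_unique by (metis (no_types, lifting) ext)
  have hB: "x * D1 - D0 = (real m + 1) * C1"
    using gegenbauer'_identities[of x l m] by (simp add: defs)
  have "(1 - x\<^sup>2) * DD - (2 * l + 1) * x * D1 + (real m + 1) * (real m + 1 + 2 * l) * C1 = 0"
    using h hB by algebra
  then show ?thesis by (simp add: Suc defs algebra_simps)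
qed

text \<open>
  At \<open>1\<close> the three-term recurrence collapses to a two-term one with positive coefficients.
\<close>

lemma gegenbauer_at_1:
  assumes "l > 0"
  shows "gegenbauer l n 1 > 0 \<and> (real n + 1) * gegenbauer l (Suc n) 1 = (real n + 2 * l) * gegenbauer l n 1"
proof (induction n)
  case (Suc n)
  have "(real n + 1) * gegenbauer l (Suc n) 1 > 0" using Suc assms by simp
  then have pos: "gegenbauer l (Suc n) 1 > 0" by (simp add: zero_less_mult_iff)
  have "(real n + 2) * gegenbauer l (Suc (Suc n)) 1
      = 2 * (real n + 1 + l) * gegenbauer l (Suc n) 1 - (real n + 2 * l) * gegenbauer l n 1" by simp
  also have "\<dots> = (real n + 1 + 2 * l) * gegenbauer l (Suc n) 1"
    using Suc by (simp add: algebra_simps)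
  finally show ?case using pos by (simp add: algebra_simps)
qed simp

lemma continuous_on_gegenbauer_cos:
  "continuous_on A (\<lambda>x. gegenbauer l n (cos x))" "continuous_on A (\<lambda>x. gegenbauer' l n (cos x))"
proof -
  have "continuous_on UNIV (gegenbauer l n)" "continuous_on UNIV (gegenbauer' l n)"
    using DERIV_isCont[OF DERIV_gegenbauer] DERIV_isCont[OF DERIV_gegenbauer']
    by (auto simp: continuous_on_eq_continuous_at)
  then show "continuous_on A (\<lambda>x. gegenbauer l n (cos x))" "continuous_on A (\<lambda>x. gegenbauer' l n (cos x))"
    by (auto intro!: continuous_on_compose2[of UNIV _ A cos] continuous_intros)
qed

text \<open>
  A vanishing norm would force the polynomial to vanish on all of \<open>(-1, 1)\<close> and, by continuity, at
  \<open>1\<close>.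
\<close>

lemma h_norm_pos: "h_norm n > 0"
proof -
  let ?G = "\<lambda>x. gegenbauer (1/4) n (cos x)"
  have int: "integrable M (\<lambda>x. omega x * (?G x)\<^sup>2)"
    by (intro integrable_M_continuous continuous_intros continuous_on_omega continuous_on_gegenbauer_cos)
  have nn: "0 \<le> omega x * (?G x)\<^sup>2" if "x \<in> space M" for x using that omega_nonneg[of x] by simp
  have "h_norm n \<noteq> 0"
  proof
    assume "h_norm n = 0"
    then have ae: "AE x in M. omega x * (?G x)\<^sup>2 = 0"
      unfolding h_norm_def by (subst (asm) integral_nonneg_eq_0_iff_AE[OF int AE_I2]) (use nn in auto)
    have "AE x in M. complex_of_real (?G x) = 0"
      using ae AE_space by eventually_elim (use omega_pos in force)
    then have "complex_of_real (?G x) = 0" if "x \<in> I0pi" for x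
      using continuous_eq_if_AE_eq[of "\<lambda>x. of_real (?G x)" "\<lambda>_. 0" x] that
      by (auto intro!: continuous_intros continuous_on_gegenbauer_cos)
    then have z: "?G x = 0" if "x \<in> I0pi" for x using that by (simp add: of_real_eq_0_iff)
    have "continuous_on {0..pi} ?G" by (rule continuous_on_gegenbauer_cos)
    from continuous_constant_on_closure[of I0pi ?G 0 0] this z
    have "?G 0 = 0" using pi_gt_zero by simp
    then show False using gegenbauer_at_1[of "1/4" n] by simp
  qed
  moreover have "0 \<le> h_norm n"
    unfolding h_norm_def by (rule Bochner_Integration.integral_nonneg) (rule nn)
  ultimately show ?thesis by linarith
qed

text \<open>
  Everywhere continuously differentiable functions are primitives of their derivatives in the sense
  above; this covers the eigenfunctions.
\<close>

lemma is_primitive_of_real: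
  fixes F F' :: "real \<Rightarrow> real"
  assumes F: "\<And>x. (F has_real_derivative F' x) (at x)" and F': "continuous_on UNIV F'"
  shows "is_primitive (of_real (F 0)) (\<lambda>x. of_real (F' x)) (\<lambda>x. of_real (F x))"
proof -
  have cF: "continuous_on A F" for A using DERIV_isCont[OF F] by (auto intro: continuous_at_imp_continuous_on)
  have cF': "continuous_on A F'" for A using F' by (rule continuous_on_subset) simp
  have prim: "primitive (\<lambda>x. of_real (F' x)) x = of_real (F x - F 0)" if x: "x \<in> I0pi" for x
  proof -
    have "primitive (\<lambda>x. of_real (F' x)) x = (LINT t|M. of_real (indicator {..<x} t * F' t))"
      unfolding primitive_def by (rule Bochner_Integration.integral_cong) (auto simp: indicator_def)
    also have "\<dots> = of_real (LINT t|M. indicator {..<x} t * F' t)"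
      by (rule integral_complex_of_real)
    also have "(LINT t|M. indicator {..<x} t * F' t)
        = (LINT t|M. indicator {0<..} t * F' t - indicator {x<..} t * F' t)"
    proof (rule integral_cong_AE)
      have [measurable]: "F' \<in> borel_measurable M" by (intro measurable_M_continuous cF')
      show "(\<lambda>t. indicator {..<x} t * F' t) \<in> borel_measurable M"
        "(\<lambda>t. indicator {0<..} t * F' t - indicator {x<..} t * F' t) \<in> borel_measurable M"
        by measurable
      have "AE t in lebesgue. t \<noteq> x" by (rule AE_completion[OF AE_lborel_singleton])
      then show "AE t in M. indicator {..<x} t * F' t = indicator {0<..} t * F' t - indicator {x<..} t * F' t"
        unfolding AE_M_iff by eventually_elim (auto simp: indicator_def)
    qed
    also have "\<dots> = (LINT t|M. indicator {0<..} t * F' t) - (LINT t|M. indicator {x<..} t * F' t)"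
    proof (rule Bochner_Integration.integral_diff)
      have "integrable M (\<lambda>t. indicator {y<..} t * F' t)" for y
      proof (rule Bochner_Integration.integrable_bound)
        show "integrable M F'" by (intro integrable_M_continuous cF')
        have [measurable]: "F' \<in> borel_measurable M" by (intro measurable_M_continuous cF')
        show "(\<lambda>t. indicator {y<..} t * F' t) \<in> borel_measurable M" by measurable
      qed (auto simp: indicator_def)
      then show "integrable M (\<lambda>t. indicator {0<..} t * F' t)" "integrable M (\<lambda>t. indicator {x<..} t * F' t)"
        by blast+
    qed
    also have "\<dots> = (F pi - F 0) - (F pi - F x)"
      using x by (intro arg_cong2[of _ _ _ _ "(-)"] integral_derivative_tail cF cF' F) auto
    finally show ?thesis by simp
  qed
  have "AE x in M. complex_of_real (F x) = of_real (F 0) + primitive (\<lambda>x. of_real (F' x)) x"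
    by (rule AE_I2) (simp add: prim)
  moreover have "integrable M (\<lambda>x. complex_of_real (F' x))"
    by (intro integrable_M_continuous continuous_intros cF')
  moreover have "(\<lambda>x. complex_of_real (F x)) \<in> borel_measurable M"
    by (intro measurable_M_continuous continuous_intros cF)
  ultimately show ?thesis by (simp add: is_primitive_def)
qed

definition phi :: "nat \<Rightarrow> real \<Rightarrow> real" where
  "phi n x = gegenbauer (1/4) n (cos x) / sqrt (h_norm n)"

definition dphi :: "nat \<Rightarrow> real \<Rightarrow> real" where
  "dphi n x = - sin x * gegenbauer' (1/4) n (cos x) / sqrt (h_norm n)"

definition dPhi :: "nat \<Rightarrow> real \<Rightarrow> complex" where
  "dPhi n x = of_real (dphi n x)"

text \<open>
  A quarter of the eigenvalue \<open>2 n (2 n + 1)\<close>: the factor \<open>4\<close> of the form is split off.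
\<close>

definition kappa :: "nat \<Rightarrow> real" where
  "kappa n = real n * (real n + 1/2)"

lemma Phi_eq: "Phi n = (\<lambda>x. of_real (phi n x))"
  by (simp add: Phi_def phi_def fun_eq_iff)

lemma continuous_on_phi: "continuous_on A (phi n)" "continuous_on A (dphi n)"
  unfolding phi_def dphi_def using h_norm_pos[of n]
  by (auto intro!: continuous_intros continuous_on_gegenbauer_cos)

lemma DERIV_phi: "(phi n has_real_derivative dphi n x) (at x)"
proof -
  have "((\<lambda>x. gegenbauer (1/4) n (cos x)) has_real_derivative gegenbauer' (1/4) n (cos x) * - sin x) (at x)"
    by (rule DERIV_chain2[OF DERIV_gegenbauer]) (auto intro!: derivative_eq_intros)
  from DERIV_cdivide[OF this, of "sqrt (h_norm n)"] show ?thesis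
    unfolding phi_def dphi_def by (simp add: mult.commute)
qed

lemma is_primitive_Phi: "is_primitive (Phi n 0) (dPhi n) (Phi n)"
  unfolding Phi_eq dPhi_def[abs_def]
  by (intro is_primitive_of_real DERIV_phi continuous_on_phi)

text \<open>
  The Gegenbauer equation for parameter \<open>1/4\<close> after the substitution \<open>cos x\<close>, in divergence form.
\<close>

lemma phi_eigenfunction:
  assumes x: "x \<in> I0pi"
  shows "((\<lambda>x. omega x * dphi n x) has_real_derivative - kappa n * (omega x * phi n x)) (at x)"
proof -
  define s c D DD C q where defs: "s = sin x" "c = cos x" "D = gegenbauer' (1/4) n (cos x)"
    "DD = deriv (gegenbauer' (1/4) n) (cos x)" "C = gegenbauer (1/4) n (cos x)" "q = sqrt (sin x)"
  have s: "0 < sin x" using x by (simp add: sin_gt_zero)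
  have q: "q \<noteq> 0" "s = q * q" using s by (simp_all add: defs)
  have dD: "((\<lambda>x. gegenbauer' (1/4) n (cos x)) has_real_derivative DD * - sin x) (at x)"
    unfolding defs by (rule DERIV_chain2[OF DERIV_gegenbauer']) (auto intro!: derivative_eq_intros)
  have dq: "((\<lambda>x. sqrt (sin x)) has_real_derivative c / (2 * q)) (at x)"
    unfolding defs using s by (auto intro!: derivative_eq_intros simp: field_simps)
  have ds: "((\<lambda>x. - sin x) has_real_derivative - c) (at x)"
    unfolding defs by (auto intro!: derivative_eq_intros)
  have "((\<lambda>x. sqrt (sin x) * (- sin x * gegenbauer' (1/4) n (cos x))) has_real_derivative
      c / (2 * q) * (- s * D) + (- c * D + DD * - s * - s) * q) (at x)"
    using DERIV_mult[OF dq DERIV_mult[OF ds dD]] by (simp add: defs)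
  moreover have "c / (2 * q) * (- s * D) + (- c * D + DD * - s * - s) * q = - kappa n * (q * C)"
  proof -
    have ode: "(1 - c\<^sup>2) * DD - (3/2) * c * D + kappa n * C = 0"
      using gegenbauer_ODE[of "cos x" "1/4" n] by (simp add: defs kappa_def)
    have s2: "1 - c\<^sup>2 = s * s" using sin_squared_eq[of x] by (simp add: defs power2_eq_square)
    have "c / (2 * q) * (- s * D) = - (1/2) * q * c * D" using q by simp
    then have "c / (2 * q) * (- s * D) + (- c * D + DD * - s * - s) * q
        = q * (s * s * DD - (3/2) * c * D)" by (simp add: algebra_simps)
    also have "s * s * DD - (3/2) * c * D = - kappa n * C" using ode s2 by simp
    finally show ?thesis by (simp add: algebra_simps)
  qed
  ultimately have "((\<lambda>x. sqrt (sin x) * (- sin x * gegenbauer' (1/4) n (cos x))) has_real_derivative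
      - kappa n * (q * C)) (at x)" by simp
  from DERIV_cdivide[OF this, of "sqrt (h_norm n)"] show ?thesis
    unfolding dphi_def phi_def omega_def defs by simp
qed

text \<open>
  Integration by parts against \<open>omega\<close> times the derivative of the eigenfunction; the boundary terms
  drop out because \<open>omega\<close> vanishes at both endpoints, whatever values \<open>f\<close> takes there.
\<close>

lemma weak_eigenfunction_identity:
  assumes f: "is_primitive c g f"
  shows "H_inner g (dPhi n) = of_real (kappa n) * H_inner f (Phi n)"
proof -
  let ?w = "\<lambda>x. omega x * dphi n x" and ?w' = "\<lambda>x. - kappa n * (omega x * phi n x)"
  have "(LINT x|M. f x * of_real (?w' x))
      = (c + primitive g pi) * of_real (?w pi) - c * of_real (?w 0) - (LINT x|M. g x * of_real (?w x))"
  proof (rule is_primitive_by_parts[OF f])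
    show "(?w has_real_derivative ?w' x) (at x)" if "x \<in> I0pi" for x
      using that by (rule phi_eigenfunction)
  qed (intro continuous_intros continuous_on_omega continuous_on_phi)+
  moreover have "?w pi = 0" "?w 0 = 0" by (simp_all add: omega_def)
  ultimately have parts: "(LINT x|M. f x * of_real (?w' x)) = - (LINT x|M. g x * of_real (?w x))"
    by simp
  have "H_inner g (dPhi n) = (LINT x|M. g x * of_real (?w x))"
    unfolding H_inner_def by (simp add: dPhi_def mult_ac)
  also have "\<dots> = - (LINT x|M. f x * of_real (?w' x))"
    unfolding parts by simp
  also have "(LINT x|M. f x * of_real (?w' x))
      = (LINT x|M. - of_real (kappa n) * (of_real (omega x) * f x * cnj (Phi n x)))"
    by (simp add: Phi_eq mult_ac)
  also have "\<dots> = - of_real (kappa n) * H_inner f (Phi n)"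
    unfolding H_inner_def by (rule integral_mult_right_zero)
  finally show ?thesis by simp
qed

section \<open>Orthogonal projections in the weighted space\<close>

lemma cnj_measurable [measurable]: "cnj \<in> borel_measurable borel"
  by (intro borel_measurable_continuous_onI continuous_intros)

lemma H_space_measurable: "u \<in> H_space \<Longrightarrow> u \<in> borel_measurable M"
  by (simp add: H_space_def)

lemma H_space_continuous:
  assumes "continuous_on {0..pi} u" shows "u \<in> H_space"
proof -
  have "continuous_on I0pi u" using assms by (rule continuous_on_subset) auto
  moreover have "integrable M (\<lambda>x. omega x * (cmod (u x))\<^sup>2)"
    by (intro integrable_M_continuous continuous_intros continuous_on_omega assms)
  ultimately show ?thesis by (auto simp: H_space_def measurable_M_continuous)
qed

lemma H_space_lincomb:
  assumes u: "u \<in> H_space" and v: "v \<in> H_space"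
  shows "(\<lambda>x. u x + c * v x) \<in> H_space"
proof -
  note [measurable] = H_space_measurable[OF u] H_space_measurable[OF v]
  have "integrable M (\<lambda>x. omega x * (cmod (u x + c * v x))\<^sup>2)"
  proof (rule Bochner_Integration.integrable_bound)
    show "integrable M (\<lambda>x. 2 * (omega x * (cmod (u x))\<^sup>2) + 2 * (cmod c)\<^sup>2 * (omega x * (cmod (v x))\<^sup>2))"
      using u v by (auto simp: H_space_def)
    show "AE x in M. norm (omega x * (cmod (u x + c * v x))\<^sup>2)
      \<le> norm (2 * (omega x * (cmod (u x))\<^sup>2) + 2 * (cmod c)\<^sup>2 * (omega x * (cmod (v x))\<^sup>2))"
    proof (rule AE_I2)
      fix x assume "x \<in> space M"
      then have om: "0 \<le> omega x" by (simp add: omega_nonneg)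
      have "(cmod (u x + c * v x))\<^sup>2 \<le> (cmod (u x) + cmod c * cmod (v x))\<^sup>2"
        by (intro power_mono) (metis norm_mult norm_triangle_ineq, simp)
      also have "\<dots> \<le> 2 * (cmod (u x))\<^sup>2 + 2 * (cmod c * cmod (v x))\<^sup>2"
        using zero_le_power2[of "cmod (u x) - cmod c * cmod (v x)"] by (simp add: power2_sum power2_diff)
      finally have "omega x * (cmod (u x + c * v x))\<^sup>2 \<le> omega x * (2 * (cmod (u x))\<^sup>2 + 2 * (cmod c * cmod (v x))\<^sup>2)"
        using om by (rule mult_left_mono)
      then show "norm (omega x * (cmod (u x + c * v x))\<^sup>2)
        \<le> norm (2 * (omega x * (cmod (u x))\<^sup>2) + 2 * (cmod c)\<^sup>2 * (omega x * (cmod (v x))\<^sup>2))"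
        using om by (simp add: power_mult_distrib algebra_simps)
    qed
  qed measurable
  then show ?thesis by (simp add: H_space_def)
qed

lemma H_space_sum:
  assumes "finite J" "\<And>n. n \<in> J \<Longrightarrow> e n \<in> H_space"
  shows "(\<lambda>x. \<Sum>n\<in>J. b n * e n x) \<in> H_space"
  using assms
proof (induction J rule: finite_induct)
  case empty
  then show ?case by (simp add: H_space_continuous)
next
  case (insert n J)
  then show ?case
    using H_space_lincomb[of "\<lambda>x. \<Sum>n\<in>J. b n * e n x" "e n" "b n"] by (simp add: add.commute)
qed

lemma H_inner_integrable:
  assumes u: "u \<in> H_space" and v: "v \<in> H_space"
  shows "integrable M (\<lambda>x. of_real (omega x) * u x * cnj (v x))"
proof (rule Bochner_Integration.integrable_bound)
  note [measurable] = H_space_measurable[OF u] H_space_measurable[OF v]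
  show "integrable M (\<lambda>x. omega x * (cmod (u x))\<^sup>2 + omega x * (cmod (v x))\<^sup>2)"
    using u v by (auto simp: H_space_def)
  show "(\<lambda>x. of_real (omega x) * u x * cnj (v x)) \<in> borel_measurable M" by measurable
  show "AE x in M. norm (of_real (omega x) * u x * cnj (v x))
      \<le> norm (omega x * (cmod (u x))\<^sup>2 + omega x * (cmod (v x))\<^sup>2)"
  proof (rule AE_I2)
    fix x assume "x \<in> space M"
    then have om: "0 \<le> omega x" by (simp add: omega_nonneg)
    have "2 * (cmod (u x) * cmod (v x)) \<le> (cmod (u x))\<^sup>2 + (cmod (v x))\<^sup>2"
      using zero_le_power2[of "cmod (u x) - cmod (v x)"] by (simp add: power2_diff)
    moreover have "0 \<le> cmod (u x) * cmod (v x)" by simp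
    ultimately have "cmod (u x) * cmod (v x) \<le> (cmod (u x))\<^sup>2 + (cmod (v x))\<^sup>2" by linarith
    then have "omega x * (cmod (u x) * cmod (v x)) \<le> omega x * ((cmod (u x))\<^sup>2 + (cmod (v x))\<^sup>2)"
      using om by (rule mult_left_mono)
    then show "norm (of_real (omega x) * u x * cnj (v x))
      \<le> norm (omega x * (cmod (u x))\<^sup>2 + omega x * (cmod (v x))\<^sup>2)"
      using om by (simp add: norm_mult algebra_simps)
  qed
qed

lemma H_inner_lincomb_left:
  assumes "u \<in> H_space" "v \<in> H_space" "w \<in> H_space"
  shows "H_inner (\<lambda>x. u x + c * v x) w = H_inner u w + c * H_inner v w"
proof -
  have "H_inner (\<lambda>x. u x + c * v x) w
    = (LINT x|M. of_real (omega x) * u x * cnj (w x) + c * (of_real (omega x) * v x * cnj (w x)))"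
    unfolding H_inner_def by (simp add: algebra_simps)
  also have "\<dots> = H_inner u w + c * H_inner v w"
    unfolding H_inner_def integral_mult_right_zero[symmetric]
    by (intro Bochner_Integration.integral_add integrable_mult_right H_inner_integrable assms)
  finally show ?thesis .
qed

lemma H_inner_commute: "H_inner v u = cnj (H_inner u v)"
proof -
  have "cnj (H_inner u v) = (LINT x|M. cnj (of_real (omega x) * u x * cnj (v x)))"
    unfolding H_inner_def by (rule Bochner_Integration.integral_cnj[symmetric])
  also have "\<dots> = H_inner v u"
    unfolding H_inner_def by (rule Bochner_Integration.integral_cong) (simp_all add: mult_ac)
  finally show ?thesis by simp
qed

lemma H_inner_sum_left:
  assumes "finite J" "\<And>n. n \<in> J \<Longrightarrow> e n \<in> H_space" "w \<in> H_space"
  shows "H_inner (\<lambda>x. \<Sum>n\<in>J. b n * e n x) w = (\<Sum>n\<in>J. b n * H_inner (e n) w)"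
  using assms
proof (induction J rule: finite_induct)
  case empty
  then show ?case by (simp add: H_inner_def)
next
  case (insert n J)
  then show ?case
    using H_inner_lincomb_left[OF H_space_sum[of J e b] _ insert.prems(2), of "e n" "b n"]
    by (simp add: add.commute)
qed

lemma H_inner_self: "H_inner u u = of_real (H_sq u)"
proof -
  have "(\<lambda>x. of_real (omega x) * u x * cnj (u x)) = (\<lambda>x. complex_of_real (omega x * (cmod (u x))\<^sup>2))"
    by (simp add: mult.assoc complex_norm_square[symmetric] del: of_real_power)
  then show ?thesis
    unfolding H_inner_def H_sq_def by (simp only: integral_complex_of_real)
qed

lemma H_sq_cong_AE:
  assumes "u \<in> borel_measurable M" "v \<in> borel_measurable M" "AE x in M. u x = v x"
  shows "H_sq u = H_sq v"
  unfolding H_sq_def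
proof (rule integral_cong_AE)
  note [measurable] = assms(1,2)
  show "(\<lambda>x. omega x * (cmod (u x))\<^sup>2) \<in> borel_measurable M"
    "(\<lambda>x. omega x * (cmod (v x))\<^sup>2) \<in> borel_measurable M" by measurable
  show "AE x in M. omega x * (cmod (u x))\<^sup>2 = omega x * (cmod (v x))\<^sup>2"
    using assms(3) by eventually_elim simp
qed

text \<open>
  Stated for an orthogonal family with arbitrary squared norms \<open>d n\<close>, so that it applies to the
  eigenfunctions and to their derivatives with the same coefficients.
\<close>

lemma H_sq_minus_projection:
  assumes u: "u \<in> H_space" and e: "\<And>n. e n \<in> H_space" and J: "finite J"
    and orth: "\<And>m n. H_inner (e m) (e n) = (if m = n then of_real (d n) else 0)"
    and coef: "\<And>n. H_inner u (e n) = b n * of_real (d n)"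
  shows "H_sq (\<lambda>x. u x - (\<Sum>n\<in>J. b n * e n x)) = H_sq u - (\<Sum>n\<in>J. d n * (cmod (b n))\<^sup>2)"
proof -
  define p where "p = (\<lambda>x. \<Sum>n\<in>J. b n * e n x)"
  define S where "S = (\<Sum>n\<in>J. d n * (cmod (b n))\<^sup>2)"
  have pH: "p \<in> H_space" unfolding p_def by (rule H_space_sum[OF J e])
  have pe: "H_inner p (e m) = b m * of_real (d m)" if "m \<in> J" for m
    unfolding p_def using that J
    by (subst H_inner_sum_left[OF J e e]) (simp add: orth if_distrib sum.delta' cong: if_cong)
  have vp: "H_inner p v = cnj (H_inner v p)" for v by (rule H_inner_commute)
  have pv: "H_inner p v = of_real S" if "\<And>n. n \<in> J \<Longrightarrow> H_inner v (e n) = b n * of_real (d n)" "v \<in> H_space" for v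
  proof -
    have "H_inner p v = (\<Sum>n\<in>J. b n * cnj (H_inner v (e n)))"
      unfolding p_def H_inner_sum_left[OF J e that(2)]
      by (intro sum.cong refl arg_cong2[of _ _ _ _ "(*)"] H_inner_commute)
    also have "\<dots> = (\<Sum>n\<in>J. complex_of_real (d n * (cmod (b n))\<^sup>2))"
    proof (rule sum.cong)
      fix n assume "n \<in> J"
      then have "b n * cnj (H_inner v (e n)) = b n * cnj (b n) * of_real (d n)" using that by simp
      also have "\<dots> = complex_of_real (d n * (cmod (b n))\<^sup>2)"
        by (simp add: complex_norm_square[symmetric] mult.commute)
      finally show "b n * cnj (H_inner v (e n)) = complex_of_real (d n * (cmod (b n))\<^sup>2)" .
    qed simp
    finally show ?thesis by (simp add: S_def)
  qed
  have pp: "H_inner p p = of_real S" by (rule pv[OF pe pH])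
  have pu: "H_inner p u = of_real S" by (rule pv[OF coef u])
  then have up: "H_inner u p = of_real S" using H_inner_commute[of u p] by simp
  let ?v = "\<lambda>x. u x + (-1) * p x"
  have vH: "?v \<in> H_space" by (rule H_space_lincomb[OF u pH])
  have vp: "H_inner ?v p = 0" unfolding H_inner_lincomb_left[OF u pH pH] by (simp add: up pp)
  have vu: "H_inner ?v u = of_real (H_sq u) - of_real S"
    unfolding H_inner_lincomb_left[OF u pH u] by (simp add: H_inner_self pu)
  have "H_inner ?v ?v = H_inner u ?v + (-1) * H_inner p ?v"
    by (rule H_inner_lincomb_left[OF u pH vH])
  also have "\<dots> = cnj (H_inner ?v u) - cnj (H_inner ?v p)"
    using H_inner_commute[of u ?v] H_inner_commute[of p ?v] by simp
  also have "\<dots> = of_real (H_sq u - S)" using vp vu by simp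
  finally have "H_sq ?v = H_sq u - S" unfolding H_inner_self of_real_eq_iff .
  then show ?thesis by (simp add: p_def S_def)
qed

lemma Phi_H_space: "Phi n \<in> H_space" "dPhi n \<in> H_space"
  unfolding Phi_eq dPhi_def[abs_def]
  by (intro H_space_continuous continuous_intros continuous_on_phi)+

text \<open>
  The weak eigenvalue identity can be read with either function as the eigenfunction, and the
  eigenvalues differ.
\<close>

lemma Phi_orthonormal: "H_inner (Phi m) (Phi n) = (if m = n then 1 else 0)"
proof (cases "m = n")
  case True
  have "H_sq (Phi n) = (LINT x|M. omega x * (gegenbauer (1/4) n (cos x))\<^sup>2 / h_norm n)"
    unfolding H_sq_def Phi_eq phi_def using h_norm_pos[of n]
    by (intro Bochner_Integration.integral_cong) (auto simp: power_divide norm_divide)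
  also have "\<dots> = h_norm n / h_norm n" unfolding h_norm_def[of n, symmetric]
    by (subst integral_divide_zero) (simp add: h_norm_def)
  finally show ?thesis using True h_norm_pos[of n] by (simp add: H_inner_self)
next
  case False
  let ?I = "H_inner (Phi m) (Phi n)"
  have 1: "H_inner (dPhi m) (dPhi n) = of_real (kappa n) * ?I"
    by (rule weak_eigenfunction_identity[OF is_primitive_Phi])
  have "H_inner (dPhi n) (dPhi m) = of_real (kappa m) * H_inner (Phi n) (Phi m)"
    by (rule weak_eigenfunction_identity[OF is_primitive_Phi])
  \<comment> \<open>Conjugation swaps the arguments, so the same number carries both eigenvalues.\<close>
  then have "cnj (H_inner (dPhi n) (dPhi m)) = of_real (kappa m) * cnj (H_inner (Phi n) (Phi m))"
    by simp
  then have 2: "H_inner (dPhi m) (dPhi n) = of_real (kappa m) * ?I"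
    by (simp only: H_inner_commute[symmetric])
  have "kappa m \<noteq> kappa n"
  proof
    assume "kappa m = kappa n"
    then have "(real m - real n) * (real m + real n + 1/2) = 0"
      unfolding kappa_def by algebra
    then show False using False by auto
  qed
  with 1 2 show ?thesis using False by (auto simp: mult_cancel_right)
qed

lemma dPhi_orthogonal:
  "H_inner (dPhi m) (dPhi n) = (if m = n then of_real (kappa n) else 0)"
  using weak_eigenfunction_identity[OF is_primitive_Phi, of m n] by (simp add: Phi_orthonormal)

definition coeff :: "(real \<Rightarrow> complex) \<Rightarrow> nat \<Rightarrow> complex" where
  "coeff f n = H_inner f (Phi n)"

lemma Phi_span_H_space: "p \<in> Phi_span N \<Longrightarrow> p \<in> H_space"
  unfolding Phi_span_def using H_space_sum[of "{..N}" Phi] Phi_H_space by auto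

lemma Phi_in_Phi_span: "n \<le> N \<Longrightarrow> Phi n \<in> Phi_span N"
  unfolding Phi_span_def
  by (rule image_eqI[of _ _ "\<lambda>m. if m = n then 1 else 0"])
     (auto simp: fun_eq_iff if_distrib[of "\<lambda>c. c * _"] sum.delta cong: if_cong)

lemma P_le_eq:
  assumes f: "f \<in> H_space"
  shows "P_le N f = (\<lambda>x. \<Sum>n\<le>N. coeff f n * Phi n x)"
  unfolding P_le_def
proof (rule the_equality)
  let ?p = "\<lambda>x. \<Sum>n\<le>N. coeff f n * Phi n x"
  have diff: "H_inner (\<lambda>x. f x - p x) (Phi m) = coeff f m - H_inner p (Phi m)" if "p \<in> H_space" for p m
    using H_inner_lincomb_left[OF f that Phi_H_space(1), of "-1" m] by (simp add: coeff_def)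
  have sum: "H_inner (\<lambda>x. \<Sum>n\<le>N. b n * Phi n x) (Phi m) = b m" if "m \<le> N" for b m
    using that by (subst H_inner_sum_left) (auto simp: Phi_H_space Phi_orthonormal if_distrib sum.delta cong: if_cong)
  have pH: "?p \<in> H_space" by (intro H_space_sum Phi_H_space) simp
  show "?p \<in> Phi_span N \<and> (\<forall>q\<in>Phi_span N. H_inner (\<lambda>x. f x - ?p x) q = 0)"
  proof (intro conjI ballI)
    show "?p \<in> Phi_span N" by (auto simp: Phi_span_def)
    fix q assume "q \<in> Phi_span N"
    then obtain b where q: "q = (\<lambda>x. \<Sum>n\<le>N. b n * Phi n x)" by (auto simp: Phi_span_def)
    let ?r = "\<lambda>x. f x - ?p x"
    have rH: "?r \<in> H_space" using H_space_lincomb[OF f pH, of "-1"] by simp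
    have "H_inner (Phi n) ?r = 0" if "n \<le> N" for n
      using H_inner_commute[of "Phi n" ?r] diff[OF pH, of n] sum[OF that] by simp
    then have "H_inner q ?r = 0"
      unfolding q by (subst H_inner_sum_left) (auto simp: Phi_H_space rH)
    then show "H_inner ?r q = 0" using H_inner_commute[of ?r q] by simp
  qed
  fix p assume p: "p \<in> Phi_span N \<and> (\<forall>q\<in>Phi_span N. H_inner (\<lambda>x. f x - p x) q = 0)"
  then obtain b where b: "p = (\<lambda>x. \<Sum>n\<le>N. b n * Phi n x)" by (auto simp: Phi_span_def)
  have "b m = coeff f m" if "m \<le> N" for m
    using p Phi_in_Phi_span[OF that] diff[OF Phi_span_H_space, of p N m] sum[OF that, of b] b by auto
  then show "p = ?p" unfolding b by auto
qed

section \<open>Completeness, spectral gap and the lower bound\<close>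

text \<open>
  The polynomials in \<open>cos x\<close> of any degree, given through the basis; the point is to
  see that all powers of \<open>cos x\<close> belong to it.
\<close>

definition cos_span :: "(real \<Rightarrow> complex) set" where
  "cos_span = (\<Union>N. Phi_span N)"

lemma Phi_span_mono: "N \<le> N' \<Longrightarrow> Phi_span N \<subseteq> Phi_span N'"
proof
  fix p assume "N \<le> N'" "p \<in> Phi_span N"
  then obtain b where b: "p = (\<lambda>x. \<Sum>n\<le>N. b n * Phi n x)" by (auto simp: Phi_span_def)
  have "p x = (\<Sum>n\<le>N'. (if n \<le> N then b n else 0) * Phi n x)" for x
    unfolding b using \<open>N \<le> N'\<close> by (intro sum.mono_neutral_cong_left) auto
  then show "p \<in> Phi_span N'"
    unfolding Phi_span_def by (intro image_eqI[of _ _ "\<lambda>n. if n \<le> N then b n else 0"]) auto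
qed

lemma cos_span_lincomb:
  assumes "p \<in> cos_span" "q \<in> cos_span"
  shows "(\<lambda>x. a * p x + c * q x) \<in> cos_span"
proof -
  obtain N N' where "p \<in> Phi_span N" "q \<in> Phi_span N'" using assms by (auto simp: cos_span_def)
  then have "p \<in> Phi_span (max N N')" "q \<in> Phi_span (max N N')"
    using Phi_span_mono[of N "max N N'"] Phi_span_mono[of N' "max N N'"] by auto
  then obtain b d where b: "p = (\<lambda>x. \<Sum>n\<le>max N N'. b n * Phi n x)"
    and d: "q = (\<lambda>x. \<Sum>n\<le>max N N'. d n * Phi n x)" by (auto simp: Phi_span_def)
  have "a * p x + c * q x = (\<Sum>n\<le>max N N'. (a * b n + c * d n) * Phi n x)" for x
    by (simp add: b d sum_distrib_left sum.distrib[symmetric] algebra_simps)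
  then have "(\<lambda>x. a * p x + c * q x) \<in> Phi_span (max N N')"
    unfolding Phi_span_def by (intro image_eqI[of _ _ "\<lambda>n. a * b n + c * d n"]) auto
  then show ?thesis by (auto simp: cos_span_def)
qed

lemma cos_span_sum:
  assumes "\<And>i. i \<in> I \<Longrightarrow> p i \<in> cos_span" "finite I"
  shows "(\<lambda>x. \<Sum>i\<in>I. a i * p i x) \<in> cos_span"
  using assms(2,1)
proof (induction I rule: finite_induct)
  case empty
  have "(\<lambda>x. 0) \<in> Phi_span 0" unfolding Phi_span_def by (rule image_eqI[of _ _ "\<lambda>_. 0"]) auto
  then show ?case by (auto simp: cos_span_def)
next
  case (insert i I)
  then show ?case
    using cos_span_lincomb[of "p i" "\<lambda>x. \<Sum>i\<in>I. a i * p i x" "a i" 1] by simp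
qed

lemma gegenbauer_cos_span: "(\<lambda>x. of_real (gegenbauer (1/4) n (cos x))) \<in> cos_span"
proof -
  have "Phi n \<in> cos_span" using Phi_in_Phi_span[of n n] by (auto simp: cos_span_def)
  from cos_span_lincomb[OF this this, of "of_real (sqrt (h_norm n))" 0]
  show ?thesis using h_norm_pos[of n] by (simp add: Phi_def)
qed

text \<open>
  The three-term recurrence solved for the product with \<open>cos x\<close>.
\<close>

lemma cos_mult_Phi_cos_span: "(\<lambda>x. of_real (cos x) * Phi n x) \<in> cos_span"
proof (cases n)
  case 0
  have "(\<lambda>x. of_real (2 / sqrt (h_norm 0)) * of_real (gegenbauer (1/4) (Suc 0) (cos x))
      + 0 * of_real (gegenbauer (1/4) 0 (cos x))) \<in> cos_span"
    by (intro cos_span_lincomb gegenbauer_cos_span)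
  moreover have "(\<lambda>x. of_real (2 / sqrt (h_norm 0)) * of_real (gegenbauer (1/4) (Suc 0) (cos x))
      + 0 * of_real (gegenbauer (1/4) 0 (cos x))) = (\<lambda>x. of_real (cos x) * Phi n x)"
    unfolding 0 Phi_def of_real_mult[symmetric] by (simp add: fun_eq_iff)
  ultimately show ?thesis by simp
next
  case (Suc m)
  let ?G = "\<lambda>k x. gegenbauer (1/4) k (cos x)"
  define d where "d = 2 * (real m + 1 + 1/4) * sqrt (h_norm (Suc m))"
  have d: "d \<noteq> 0" using h_norm_pos[of "Suc m"] by (simp add: d_def)
  have "(\<lambda>x. of_real ((real m + 2) / d) * of_real (?G (Suc (Suc m)) x)
      + of_real ((real m + 2 * (1/4)) / d) * of_real (?G m x)) \<in> cos_span"
    by (intro cos_span_lincomb gegenbauer_cos_span)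
  moreover have "cos x * (?G (Suc m) x / sqrt (h_norm (Suc m)))
      = (real m + 2) / d * ?G (Suc (Suc m)) x + (real m + 2 * (1/4)) / d * ?G m x" for x
  proof -
    have "(real m + 2) * ?G (Suc (Suc m)) x + (real m + 2 * (1/4)) * ?G m x
        = 2 * (real m + 1 + 1/4) * cos x * ?G (Suc m) x" by simp
    then have "(real m + 2) / d * ?G (Suc (Suc m)) x + (real m + 2 * (1/4)) / d * ?G m x
        = 2 * (real m + 1 + 1/4) * cos x * ?G (Suc m) x / d"
      unfolding times_divide_eq_left add_divide_distrib[symmetric] by (rule arg_cong)
    then show ?thesis unfolding d_def by (simp del: gegenbauer.simps)
  qed
  then have "of_real (cos x) * Phi n x = of_real ((real m + 2) / d) * of_real (?G (Suc (Suc m)) x)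
      + of_real ((real m + 2 * (1/4)) / d) * of_real (?G m x)" for x
    unfolding Suc Phi_def of_real_mult[symmetric] of_real_add[symmetric] by (rule arg_cong)
  ultimately show ?thesis by (simp only:)
qed

lemma cos_span_mult_cos:
  assumes "p \<in> cos_span" shows "(\<lambda>x. of_real (cos x) * p x) \<in> cos_span"
proof -
  obtain N b where "p = (\<lambda>x. \<Sum>n\<le>N. b n * Phi n x)" using assms by (auto simp: cos_span_def Phi_span_def)
  then have "(\<lambda>x. of_real (cos x) * p x) = (\<lambda>x. \<Sum>n\<le>N. b n * (of_real (cos x) * Phi n x))"
    by (simp add: sum_distrib_left mult_ac)
  moreover have "\<dots> \<in> cos_span" by (intro cos_span_sum cos_mult_Phi_cos_span) simp
  ultimately show ?thesis by simp
qed

lemma cos_power_cos_span: "(\<lambda>x. of_real (cos x ^ n)) \<in> cos_span"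
proof (induction n)
  case 0
  show ?case using gegenbauer_cos_span[of 0] by simp
next
  case (Suc n)
  from cos_span_mult_cos[OF Suc] show ?case by simp
qed

lemma real_polynomial_cos_span:
  assumes "real_polynomial_function r"
  shows "(\<lambda>x. of_real (r (cos x))) \<in> cos_span"
proof -
  obtain a n where "r = (\<lambda>x. \<Sum>i\<le>n. a i * x^i)"
    using assms unfolding real_polynomial_function_iff_sum by blast
  then have "(\<lambda>x. complex_of_real (r (cos x))) = (\<lambda>x. \<Sum>i\<le>n. of_real (a i) * of_real (cos x ^ i))"
    by simp
  also have "\<dots> \<in> cos_span" by (intro cos_span_sum cos_power_cos_span) simp
  finally show ?thesis .
qed

text \<open>
  The Weierstrass theorem for \<open>F (arccos y)\<close> on \<open>[-1, 1]\<close>, for real and imaginary parts.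
\<close>

lemma uniform_approximation_cos_span:
  assumes F: "continuous_on {0..pi} F" and \<epsilon>: "0 < \<epsilon>"
  shows "\<exists>p\<in>cos_span. \<forall>x\<in>I0pi. cmod (F x - p x) \<le> \<epsilon>"
proof -
  let ?S = "{- 1..1::real}"
  have arccos: "arccos y \<in> {0..pi}" if "y \<in> ?S" for y
    using that arccos_lbound arccos_ubound by auto
  have cont: "continuous_on ?S (\<lambda>y. F (arccos y))"
    by (rule continuous_on_compose2[OF F continuous_on_arccos']) (use arccos in auto)
  have "continuous_on ?S (\<lambda>y. Re (F (arccos y)))" by (intro continuous_on_Re cont)
  then obtain r where r: "real_polynomial_function r" "\<And>y. y \<in> ?S \<Longrightarrow> \<bar>Re (F (arccos y)) - r y\<bar> < \<epsilon>/2"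
    using Stone_Weierstrass_real_polynomial_function[of ?S _ "\<epsilon>/2"] \<epsilon> by (metis compact_Icc half_gt_zero)
  have "continuous_on ?S (\<lambda>y. Im (F (arccos y)))" by (intro continuous_on_Im cont)
  then obtain s where s: "real_polynomial_function s" "\<And>y. y \<in> ?S \<Longrightarrow> \<bar>Im (F (arccos y)) - s y\<bar> < \<epsilon>/2"
    using Stone_Weierstrass_real_polynomial_function[of ?S _ "\<epsilon>/2"] \<epsilon> by (metis compact_Icc half_gt_zero)
  let ?p = "\<lambda>x. 1 * complex_of_real (r (cos x)) + \<i> * of_real (s (cos x))"
  have "?p \<in> cos_span" by (intro cos_span_lincomb real_polynomial_cos_span r s)
  moreover have "cmod (F x - ?p x) \<le> \<epsilon>" if "x \<in> I0pi" for x
  proof -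
    have x: "arccos (cos x) = x" using that by (intro arccos_cos) auto
    have "cmod (F x - ?p x) \<le> \<bar>Re (F x - ?p x)\<bar> + \<bar>Im (F x - ?p x)\<bar>" by (rule cmod_le)
    also have "\<dots> \<le> \<epsilon>/2 + \<epsilon>/2"
      using r(2)[of "cos x"] s(2)[of "cos x"] by (intro add_mono) (auto simp: x)
    finally show ?thesis by simp
  qed
  ultimately show ?thesis by (intro bexI[of _ ?p] ballI)
qed

lemma bessel_residual:
  assumes "f \<in> H_space"
  shows "H_sq (\<lambda>x. f x - (\<Sum>n\<le>N. coeff f n * Phi n x)) = H_sq f - (\<Sum>n\<le>N. (cmod (coeff f n))\<^sup>2)"
proof -
  have "H_sq (\<lambda>x. f x - (\<Sum>n\<in>{..N}. coeff f n * Phi n x))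
      = H_sq f - (\<Sum>n\<in>{..N}. 1 * (cmod (coeff f n))\<^sup>2)"
    by (rule H_sq_minus_projection[OF assms Phi_H_space(1)])
       (simp_all add: Phi_orthonormal coeff_def)
  then show ?thesis by simp
qed

text \<open>
  Subtracting an element of the span changes the coefficients but not the residual, and a residual
  is never larger than the function itself.
\<close>

lemma projection_minimizes:
  assumes f: "f \<in> H_space" and p: "p \<in> Phi_span N"
  shows "H_sq (\<lambda>x. f x - (\<Sum>n\<le>N. coeff f n * Phi n x)) \<le> H_sq (\<lambda>x. f x - p x)"
proof -
  obtain b where b: "p = (\<lambda>x. \<Sum>n\<le>N. b n * Phi n x)" using p by (auto simp: Phi_span_def)
  have pH: "p \<in> H_space" using p by (rule Phi_span_H_space)
  let ?u = "\<lambda>x. f x - p x"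
  have uH: "?u \<in> H_space" using H_space_lincomb[OF f pH, of "-1"] by simp
  have cu: "coeff ?u n = coeff f n - b n" if "n \<le> N" for n
  proof -
    have "coeff ?u n = coeff f n - H_inner p (Phi n)"
      using H_inner_lincomb_left[OF f pH Phi_H_space(1), of "-1" n] by (simp add: coeff_def)
    also have "H_inner p (Phi n) = b n"
      unfolding b using that
      by (subst H_inner_sum_left) (auto simp: Phi_H_space Phi_orthonormal if_distrib sum.delta cong: if_cong)
    finally show ?thesis .
  qed
  have "(\<lambda>x. f x - (\<Sum>n\<le>N. coeff f n * Phi n x)) = (\<lambda>x. ?u x - (\<Sum>n\<le>N. coeff ?u n * Phi n x))"
  proof
    fix x
    have "(\<Sum>n\<le>N. coeff ?u n * Phi n x) = (\<Sum>n\<le>N. coeff f n * Phi n x) - p x"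
      unfolding b sum_subtractf[symmetric] by (intro sum.cong) (simp_all add: cu[unfolded b] algebra_simps)
    then show "f x - (\<Sum>n\<le>N. coeff f n * Phi n x) = ?u x - (\<Sum>n\<le>N. coeff ?u n * Phi n x)" by simp
  qed
  then have "H_sq (\<lambda>x. f x - (\<Sum>n\<le>N. coeff f n * Phi n x)) = H_sq ?u - (\<Sum>n\<le>N. (cmod (coeff ?u n))\<^sup>2)"
    using bessel_residual[OF uH, of N] by simp
  also have "\<dots> \<le> H_sq ?u" by (simp add: sum_nonneg)
  finally show ?thesis .
qed

lemma omega_le_1: "omega x \<le> 1"
  by (simp add: omega_def)

text \<open>
  Uniform approximation of the continuous representative dominates the weighted norm, and the
  projection does at least as well as the approximating polynomial.
\<close>

lemma Phi_complete:
  assumes f: "is_primitive c g f" and fH: "f \<in> H_space" and \<epsilon>: "0 < \<epsilon>"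
  shows "\<exists>N0. \<forall>N\<ge>N0. H_sq (\<lambda>x. f x - (\<Sum>n\<le>N. coeff f n * Phi n x)) \<le> \<epsilon>"
proof -
  have g: "integrable M g" and ae: "AE x in M. f x = c + primitive g x" and fm: "f \<in> borel_measurable M"
    using f by (auto simp: is_primitive_def)
  have cF: "continuous_on {0..pi} (\<lambda>x. c + primitive g x)"
    by (intro continuous_intros continuous_on_primitive g)
  \<comment> \<open>The interval has length \<open>\<pi>\<close> and the weight is at most \<open>1\<close>, so this accuracy gives \<open>\<epsilon>\<close>.\<close>
  obtain p where p: "p \<in> cos_span" "\<And>x. x \<in> I0pi \<Longrightarrow> cmod (c + primitive g x - p x) \<le> sqrt (\<epsilon>/pi)"
    using uniform_approximation_cos_span[OF cF, of "sqrt (\<epsilon>/pi)"] \<epsilon> by auto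
  obtain N0 where N0: "p \<in> Phi_span N0" using p(1) by (auto simp: cos_span_def)
  have pH: "p \<in> H_space" using N0 by (rule Phi_span_H_space)
  have uH: "(\<lambda>x. f x - p x) \<in> H_space" using H_space_lincomb[OF fH pH, of "-1"] by simp
  have "H_sq (\<lambda>x. f x - p x) \<le> (LINT x|M. \<epsilon>/pi)"
    unfolding H_sq_def
  proof (rule integral_mono_AE)
    show "integrable M (\<lambda>x. omega x * (cmod (f x - p x))\<^sup>2)" using uH by (simp add: H_space_def)
    show "AE x in M. omega x * (cmod (f x - p x))\<^sup>2 \<le> \<epsilon>/pi"
      using ae AE_space
    proof eventually_elim
      case (elim x)
      then have "cmod (f x - p x) \<le> sqrt (\<epsilon>/pi)" using p(2) by simp
      then have "(cmod (f x - p x))\<^sup>2 \<le> (sqrt (\<epsilon>/pi))\<^sup>2" by (rule power_mono) simp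
      also have "\<dots> = \<epsilon>/pi" using \<epsilon> by simp
      finally have "omega x * (cmod (f x - p x))\<^sup>2 \<le> 1 * (\<epsilon>/pi)"
        using elim omega_nonneg[of x] omega_le_1 by (intro mult_mono) auto
      then show ?case by simp
    qed
  qed simp
  also have "\<dots> = \<epsilon>" by (simp add: measure_restrict_space)
  finally have "H_sq (\<lambda>x. f x - p x) \<le> \<epsilon>" .
  then have "H_sq (\<lambda>x. f x - (\<Sum>n\<le>N. coeff f n * Phi n x)) \<le> \<epsilon>" if "N \<ge> N0" for N
    using projection_minimizes[OF fH, of p N] Phi_span_mono[OF that] N0 by force
  then show ?thesis by blast
qed

lemma kappa_mono: "m \<le> n \<Longrightarrow> kappa m \<le> kappa n"
  unfolding kappa_def by (intro mult_mono) auto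

lemma derivative_residual:
  assumes f: "is_primitive c g f" and gH: "g \<in> H_space"
  shows "H_sq (\<lambda>x. g x - (\<Sum>n\<le>N. coeff f n * dPhi n x))
           = H_sq g - (\<Sum>n\<le>N. kappa n * (cmod (coeff f n))\<^sup>2)"
  by (rule H_sq_minus_projection[OF gH Phi_H_space(2)])
     (auto simp: dPhi_orthogonal weak_eigenfunction_identity[OF f] coeff_def mult.commute)

text \<open>
  Between \<open>N\<close> and a larger index \<open>K\<close> both residuals lose the same coefficients, weighted with
  \<open>kappa n \<ge> kappa (Suc N)\<close> for the derivative. The residual of \<open>f\<close> at \<open>K\<close> tends to zero by
  completeness, and that of the derivative stays nonnegative.
\<close>

lemma spectral_gap:
  assumes f: "is_primitive c g f" and fH: "f \<in> H_space" and gH: "g \<in> H_space"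
  shows "kappa (Suc N) * H_sq (\<lambda>x. f x - (\<Sum>n\<le>N. coeff f n * Phi n x))
           \<le> H_sq (\<lambda>x. g x - (\<Sum>n\<le>N. coeff f n * dPhi n x))"
proof -
  define R where "R = (\<lambda>K. H_sq (\<lambda>x. f x - (\<Sum>n\<le>K. coeff f n * Phi n x)))"
  define E where "E = (\<lambda>K. H_sq (\<lambda>x. g x - (\<Sum>n\<le>K. coeff f n * dPhi n x)))"
  let ?a = "\<lambda>n. (cmod (coeff f n))\<^sup>2"
  have kpos: "0 < kappa (Suc N)" by (simp add: kappa_def)
  have key: "kappa (Suc N) * (R N - R K) \<le> E N" if "N \<le> K" for K
  proof -
    have split: "(\<Sum>n\<le>K. h n) = (\<Sum>n\<le>N. h n) + (\<Sum>n\<in>{Suc N..K}. h n)" for h :: "nat \<Rightarrow> real"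
    proof -
      have "{..K} = {..N} \<union> {Suc N..K}" using that by auto
      then show ?thesis by (simp add: sum.union_disjoint)
    qed
    have "kappa (Suc N) * (R N - R K) = (\<Sum>n\<in>{Suc N..K}. kappa (Suc N) * ?a n)"
      unfolding R_def bessel_residual[OF fH] split[of ?a] by (simp add: sum_distrib_left)
    also have "\<dots> \<le> (\<Sum>n\<in>{Suc N..K}. kappa n * ?a n)"
      by (intro sum_mono mult_right_mono kappa_mono) auto
    also have "\<dots> = E N - E K"
      unfolding E_def derivative_residual[OF f gH] split[of "\<lambda>n. kappa n * ?a n"] by simp
    also have "\<dots> \<le> E N" using H_sq_nonneg by (simp add: E_def)
    finally show ?thesis .
  qed
  have "kappa (Suc N) * R N \<le> E N"
  proof (rule field_le_epsilon)
    fix \<epsilon> :: real assume \<epsilon>: "0 < \<epsilon>"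
    then have "0 < \<epsilon> / kappa (Suc N)" using kpos by simp
    then obtain N0 where N0: "\<And>K. K \<ge> N0 \<Longrightarrow> R K \<le> \<epsilon> / kappa (Suc N)"
      using Phi_complete[OF f fH] unfolding R_def by blast
    have "kappa (Suc N) * R (max N N0) \<le> \<epsilon>"
      using N0[of "max N N0"] kpos by (simp add: field_simps)
    then show "kappa (Suc N) * R N \<le> E N + \<epsilon>"
      using key[of "max N N0"] by (simp add: algebra_simps)
  qed
  then show ?thesis by (simp add: R_def E_def)
qed

lemma Re_a0_form:
  assumes "is_primitive c g f"
  shows "Re (a0_form f f) = 4 * H_sq g"
proof -
  have wd: "has_weak_deriv f (weak_deriv f)"
    unfolding weak_deriv_def by (rule someI[of "has_weak_deriv f", OF is_primitive_has_weak_deriv[OF assms]])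
  have "H_sq (weak_deriv f) = H_sq g"
  proof (rule H_sq_cong_AE)
    show "AE x in M. weak_deriv f x = g x" by (rule weak_deriv_is_primitive[OF assms])
    show "weak_deriv f \<in> borel_measurable M" using wd by (simp add: has_weak_deriv_def L1_loc_def)
    show "g \<in> borel_measurable M" using assms by (auto simp: is_primitive_def)
  qed
  then show ?thesis
    unfolding a0_form_diag H_sq_def[symmetric] by simp
qed

lemma is_primitive_minus_projection:
  assumes "is_primitive c g f"
  shows "\<exists>c'. is_primitive c' (\<lambda>x. g x - (\<Sum>n\<le>N. b n * dPhi n x)) (\<lambda>x. f x - (\<Sum>n\<le>N. b n * Phi n x))"
proof (induction N)
  case 0
  then show ?case using is_primitive_lincomb[OF assms is_primitive_Phi, of "- b 0" 0] by auto
next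
  case (Suc N)
  then obtain c' where "is_primitive c' (\<lambda>x. g x - (\<Sum>n\<le>N. b n * dPhi n x)) (\<lambda>x. f x - (\<Sum>n\<le>N. b n * Phi n x))"
    by blast
  from is_primitive_lincomb[OF this is_primitive_Phi, of "- b (Suc N)" "Suc N"]
  show ?case by (auto simp: algebra_simps)
qed

theorem theorem8p3:
  "\<exists>C0 C :: real. C0 > 0 \<and> C > 0 \<and>
     (\<forall>(N :: nat) (\<mu> :: real) (\<beta>0 :: real) (\<beta>\<pi> :: real).
        N \<ge> 1 \<longrightarrow> \<mu> \<ge> 0 \<longrightarrow> real N \<ge> C0 * (1 + \<mu>\<^sup>2) \<longrightarrow> \<bar>\<beta>0\<bar> + \<bar>\<beta>\<pi>\<bar> \<le> \<mu> \<longrightarrow>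
        (\<forall>f\<in>V_space.
           Re (robin_form \<beta>0 \<beta>\<pi> f f)
             \<ge> 1/2 * Re (a0_form (P_gt N f) (P_gt N f))
               - C * (real N)\<^sup>2 * (H_norm (P_le N f))\<^sup>2))"
proof (rule exI[of _ "576::real"], rule exI[of _ "1::real"], intro conjI allI impI ballI)
  fix N :: nat and \<mu> \<beta>0 \<beta>\<pi> :: real and f
  assume N: "1 \<le> N" and \<mu>: "0 \<le> \<mu>" and N\<mu>: "576 * (1 + \<mu>\<^sup>2) \<le> real N"
    and \<beta>: "\<bar>\<beta>0\<bar> + \<bar>\<beta>\<pi>\<bar> \<le> \<mu>" and f: "f \<in> V_space"
  define g where "g = weak_deriv f"
  have fH: "f \<in> H_space" using f by (simp add: V_space_def)
  obtain c where prim: "is_primitive c g f" and gH: "g \<in> H_space"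
    using V_space_is_primitive[OF f] unfolding g_def by blast
  define q where "q = (\<lambda>x. f x - (\<Sum>n\<le>N. coeff f n * Phi n x))"
  define q' where "q' = (\<lambda>x. g x - (\<Sum>n\<le>N. coeff f n * dPhi n x))"
  define P where "P = (\<Sum>n\<le>N. (cmod (coeff f n))\<^sup>2)"
  have P_gt: "P_gt N f = q" by (simp add: P_gt_def P_le_eq[OF fH] q_def)
  obtain c' where "is_primitive c' q' q"
    using is_primitive_minus_projection[OF prim] unfolding q_def q'_def by blast
  then have a0q: "Re (a0_form q q) = 4 * H_sq q'" by (rule Re_a0_form)
  have a0f: "Re (a0_form f f) = 4 * H_sq g" by (rule Re_a0_form[OF prim])
  have Hf: "H_sq f = P + H_sq q" unfolding q_def bessel_residual[OF fH] P_def by simp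
  have Hg: "H_sq q' \<le> H_sq g"
    unfolding q'_def derivative_residual[OF prim gH] by (simp add: sum_nonneg kappa_def)
  have HP: "(H_norm (P_le N f))\<^sup>2 = P"
  proof -
    have pH: "P_le N f \<in> H_space" unfolding P_le_eq[OF fH] by (intro H_space_sum Phi_H_space) simp
    have co: "coeff (P_le N f) n = (if n \<le> N then coeff f n else 0)" for n
      unfolding P_le_eq[OF fH] coeff_def[of "\<lambda>x. \<Sum>n\<le>N. coeff f n * Phi n x"]
      by (subst H_inner_sum_left) (auto simp: Phi_H_space Phi_orthonormal if_distrib sum.delta cong: if_cong)
    have "0 = H_sq (\<lambda>x. P_le N f x - (\<Sum>n\<le>N. coeff (P_le N f) n * Phi n x))"
      unfolding co by (simp add: P_le_eq[OF fH] H_sq_def)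
    also have "\<dots> = H_sq (P_le N f) - (\<Sum>n\<le>N. (cmod (coeff (P_le N f) n))\<^sup>2)"
      by (rule bessel_residual[OF pH])
    also have "(\<Sum>n\<le>N. (cmod (coeff (P_le N f) n))\<^sup>2) = P" by (simp add: co P_def)
    finally show ?thesis by (simp add: H_norm_power2)
  qed
  have gap: "(real N)\<^sup>2 * H_sq q \<le> H_sq q'"
  proof -
    have "(real N)\<^sup>2 \<le> kappa (Suc N)" by (simp add: kappa_def power2_eq_square algebra_simps)
    then have "(real N)\<^sup>2 * H_sq q \<le> kappa (Suc N) * H_sq q" using H_sq_nonneg by (rule mult_right_mono)
    also have "\<dots> \<le> H_sq q'" unfolding q_def q'_def by (rule spectral_gap[OF prim fH gH])
    finally show ?thesis .
  qed
  \<comment> \<open>The cutoff width is \<open>\<delta> = 1 / N\<close>, for which both terms of the trace inequality scale alike on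
    functions of frequency \<open>N\<close>.\<close>
  define r where "r = sqrt (1 / real N)"
  have Npos: "0 < real N" using N by simp
  have \<delta>: "0 < 1 / real N" "1 / real N \<le> 1" using N by auto
  define T where "T = H_sq g + (real N)\<^sup>2 * H_sq f"
  have trace: "(cmod (endpoint_value f e))\<^sup>2 \<le> 24 * r * T" if "e \<in> {0, pi}" for e
    using trace_inequality[OF prim fH gH that \<delta>] by (simp add: r_def T_def power_divide algebra_simps)
  have T0: "0 \<le> T" by (simp add: T_def H_sq_nonneg)
  \<comment> \<open>Here the constant \<open>576 = 24\<^sup>2\<close> enters.\<close>
  have small: "\<mu> * (24 * r) \<le> 1"
  proof -
    have "(\<mu> * (24 * r))\<^sup>2 = 576 * \<mu>\<^sup>2 / real N"
      by (simp add: r_def power_mult_distrib)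
    also have "\<dots> \<le> 1" using N\<mu> Npos by (simp add: field_simps)
    finally show ?thesis using power2_le_imp_le[of "\<mu> * (24 * r)" 1] by simp
  qed
  have bdry: "- T \<le> \<beta>0 * (cmod (endpoint_value f 0))\<^sup>2 + \<beta>\<pi> * (cmod (endpoint_value f pi))\<^sup>2"
  proof -
    have lower: "- (\<bar>\<beta>\<bar> * (24 * r * T)) \<le> \<beta> * (cmod (endpoint_value f e))\<^sup>2" if "e \<in> {0, pi}" for \<beta> e
    proof -
      have "\<bar>\<beta> * (cmod (endpoint_value f e))\<^sup>2\<bar> \<le> \<bar>\<beta>\<bar> * (24 * r * T)"
        unfolding abs_mult using trace[OF that] by (intro mult_left_mono) auto
      then show ?thesis by linarith
    qed
    have "(\<bar>\<beta>0\<bar> + \<bar>\<beta>\<pi>\<bar>) * (24 * r * T) \<le> \<mu> * (24 * r * T)"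
      using \<beta> T0 by (intro mult_right_mono) (auto simp: r_def)
    also have "\<dots> \<le> 1 * T" using mult_right_mono[OF small T0] by (simp add: mult_ac)
    finally show ?thesis using lower[of 0 \<beta>0] lower[of pi \<beta>\<pi>] by (simp add: distrib_right)
  qed
  have "Re (robin_form \<beta>0 \<beta>\<pi> f f)
      = 4 * H_sq g + (\<beta>0 * (cmod (endpoint_value f 0))\<^sup>2 + \<beta>\<pi> * (cmod (endpoint_value f pi))\<^sup>2)"
    unfolding robin_form_def
    by (simp add: a0f mult.assoc complex_norm_square[symmetric])
  also have "\<dots> \<ge> 4 * H_sq g - T" using bdry by simp
  moreover have "4 * H_sq g - T = 3 * H_sq g - (real N)\<^sup>2 * H_sq q - (real N)\<^sup>2 * P"
    by (simp add: T_def Hf algebra_simps)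
  ultimately have "Re (robin_form \<beta>0 \<beta>\<pi> f f) \<ge> 2 * H_sq q' - (real N)\<^sup>2 * P"
    using gap Hg by linarith
  then show "Re (robin_form \<beta>0 \<beta>\<pi> f f)
      \<ge> 1/2 * Re (a0_form (P_gt N f) (P_gt N f)) - 1 * (real N)\<^sup>2 * (H_norm (P_le N f))\<^sup>2"
    unfolding P_gt a0q HP by simp
qed simp_all

end
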